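(* Let $l$ be a positive integer and let $1=t_0<t_1<t_2<\cdots<t_l$ be integers such that $t_1\mid t_2\mid\cdots\mid t_l$. When $l>1$, let $s_2$ be defined by $t_2=s_2t_1$. Let $r$ be a nonnegative integer and let $\delta,n,k$ be positive integers satisfying $r+1\leq\delta\leq n-r$, $t_{l-1}<n-r\leq t_l$, $k=n-\delta+1$ and $k\leq t_1$. Let $\mathcal F=[\gamma_0,\gamma_1,\ldots,\gamma_{n-1}]$ be an $m\times n$ Ferrers diagram (so $m=\gamma_{n-1}$). Suppose that for some $w\in\{1,2,\ldots,s_2\}$ if $l>1$, and for $w=1$ if $l=1$, the following hold: (1) $\gamma_{k-1}\leq wt_1$; (2) $\gamma_k\geq wt_1$ if $k<t_1$ and $\delta\geq 2$; (3) $\gamma_{t_\theta}\geq t_{\theta+1}$ for all $1\leq\theta\leq l-1$; (4) $\gamma_{n-r+h}\geq t_l+\sum_{j=0}^{h}\gamma_j$ for all $0\leq h\leq r-1$. Then for any prime power $q$ there exists an optimal $[\mathcal F,\sum_{i=0}^{k-1}\gamma_i,\delta]_q$ code.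
   Context: Ferrers diagrams. For positive integers $m,n$, an $m\times n$ Ferrers diagram is an $m\times n$ array of dots and empty cells such that all dots are shifted to the right, the number of dots in each row is at most the number of dots in the previous row, the first row has $n$ dots and the rightmost column has $m$ dots. It is identified with its column cardinalities: $\mathcal F=[\gamma_0,\gamma_1,\ldots,\gamma_{n-1}]$ with $1\leq\gamma_0\leq\gamma_1\leq\cdots\leq\gamma_{n-1}=m$, where the $(j+1)$-th column from the left has exactly $\gamma_j$ dots, located in its top $\gamma_j$ cells. Codes. For an $m\times n$ Ferrers diagram $\mathcal F$ and a prime power $q$, an $[\mathcal F,k,\delta]_q$ code (Ferrers diagram rank-metric code) is a $k$-dimensional $\mathbb F_q$-linear subspace of $\mathbb F_q^{m\times n}$ with minimum rank distance $\delta$ (the minimum of the ranks of its nonzero matrices), such that in every matrix of the code all entries at positions not in $\mathcal F$ are zero. Optimality. For $0\leq i\leq\delta-1$ let $v_i$ be the number of dots of $\mathcal F$ that are not contained in the first $i$ rows and are not contained in the rightmost $\delta-1-i$ columns. Every $[\mathcal F,k,\delta]_q$ code satisfies $k\leq\min_{0\leq i\leq\delta-1}v_i$; the code is called optimal if equality holds. *)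

theory Defs
  imports "HOL-Library.Cardinality" "HOL-Number_Theory.Prime_Powers" "Jordan_Normal_Form.DL_Rank"
begin

(* A Ferrers diagram is identified with its list of column cardinalities, leftmost column first. *)
definition ferrers_diagram :: "nat \<Rightarrow> nat \<Rightarrow> nat list \<Rightarrow> bool" where
  "ferrers_diagram m n \<gamma> \<longleftrightarrow>
     0 < m \<and> 0 < n \<and> length \<gamma> = n \<and> 1 \<le> \<gamma> ! 0 \<and> sorted \<gamma> \<and> \<gamma> ! (n - 1) = m"

(* Positions (row, column), both counted from 0, top to bottom and left to right. *)
definition dots :: "nat list \<Rightarrow> (nat \<times> nat) set" where
  "dots \<gamma> = {(a, b). b < length \<gamma> \<and> a < \<gamma> ! b}"

(* The last condition says that column b is not among the rightmost \<delta> - 1 - i columns. *)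
definition ferrers_v :: "nat list \<Rightarrow> nat \<Rightarrow> nat \<Rightarrow> nat" where
  "ferrers_v \<gamma> \<delta> i = card {(a, b) \<in> dots \<gamma>. i \<le> a \<and> b + (\<delta> - 1 - i) < length \<gamma>}"

definition min_rank_distance :: "nat \<Rightarrow> nat \<Rightarrow> 'a::field mat set \<Rightarrow> nat \<Rightarrow> bool" where
  "min_rank_distance m n C \<delta> \<longleftrightarrow>
     (\<exists>A\<in>C. A \<noteq> 0\<^sub>m m n \<and> vec_space.rank m A = \<delta>) \<and>
     (\<forall>A\<in>C. A \<noteq> 0\<^sub>m m n \<longrightarrow> \<delta> \<le> vec_space.rank m A)"

(* An [F, k, \<delta>]_q code, where the field with q elements is the type 'a. *)
definition ferrers_code ::
    "nat \<Rightarrow> nat \<Rightarrow> nat list \<Rightarrow> nat \<Rightarrow> nat \<Rightarrow> 'a::{field,finite} mat set \<Rightarrow> bool" where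
  "ferrers_code m n \<gamma> k \<delta> C \<longleftrightarrow>
     VectorSpace.subspace class_ring C (module_mat TYPE('a) m n) \<and>
     vectorspace.dim class_ring ((module_mat TYPE('a) m n)\<lparr>carrier := C\<rparr>) = k \<and>
     min_rank_distance m n C \<delta> \<and>
     (\<forall>A\<in>C. \<forall>a<m. \<forall>b<n. (a, b) \<notin> dots \<gamma> \<longrightarrow> A $$ (a, b) = 0)"

definition optimal_ferrers_code ::
    "nat \<Rightarrow> nat \<Rightarrow> nat list \<Rightarrow> nat \<Rightarrow> nat \<Rightarrow> 'a::{field,finite} mat set \<Rightarrow> bool" where
  "optimal_ferrers_code m n \<gamma> k \<delta> C \<longleftrightarrow>
     ferrers_code m n \<gamma> k \<delta> C \<and> k = (MIN i\<in>{0..\<delta> - 1}. ferrers_v \<gamma> \<delta> i)"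

end

theory Submission
  imports Defs "HOL-Algebra.Algebraic_Closure_Type" "HOL-Number_Theory.Residues"
begin

text \<open>
  Let \<open>q\<close> be the size of the base field, \<open>s = n - r\<close> and \<open>T = t\<^sub>l\<close>. The first \<open>s\<close> columns carry a Gabidulin code:
  column \<open>b\<close> holds the coordinates of \<open>f(g\<^sub>b)\<close>, where \<open>f\<close> runs through \<open>q\<close>-polynomials of \<open>q\<close>-degree
  less than \<open>k\<close> and the \<open>g\<^sub>b\<close> form a basis of the field of size \<open>q\<^sup>T\<close> adapted to the flag
  of its subfields of sizes \<open>q\<close> to the \<open>t\<^sub>1, \<dots>, t\<^sub>l\<close>, refined by a \<open>w\<close>-dimensional space over the smallest of them.
  The first \<open>k\<close> values are free and are confined to the diagram; since the interpolation data lie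
  in subfields, the remaining values stay in the members of the flag and hence fit into their columns.

  Each of the last \<open>r\<close> columns holds one further evaluation in its top \<open>T\<close> rows, and copies of the free
  values below it. If \<open>j\<close> is the first index of a nonzero free value, then the copies
  form a staircase which contributes \<open>r - j\<close> to the rank, while \<open>f\<close> factors through a \<open>q\<close>-polynomial
  vanishing on \<open>g\<^sub>0, \<dots>, g\<^bsub>j-1\<^esub>\<close>. The cofactor has \<open>q\<close>-degree less than \<open>k - j\<close> and is evaluated
  at \<open>s\<close> independent points, and the bound on its number of zeros yields the distance.
  All dimensions are obtained by counting elements.
\<close>

no_notation fps_nth (infixl "$" 75)

subsection \<open>Counting in spaces of matrices over a finite field\<close>

lemma card_PiE_UNIV:
  assumes "finite I"
  shows "card (PiE I (\<lambda>_. UNIV :: 'a::finite set)) = CARD('a) ^ card I"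
  using assms by (simp add: card_PiE)

lemma one_less_CARD_field: "1 < CARD('a::{field,finite})"
proof -
  have "card {0, 1 :: 'a} \<le> CARD('a)"
    by (rule card_mono) auto
  thus ?thesis by simp
qed

text \<open>The map \<open>d\<close> plays the role of the difference \<open>y - x\<close>: with a
  base point chosen in a fibre of \<open>f\<close>, it injects that fibre into \<open>Z\<close>, so
  no fibre is larger than \<open>Z\<close>.\<close>

lemma card_le_card_image_times:
  assumes "finite Y" "finite Z"
    and "\<And>x. x \<in> Y \<Longrightarrow> inj_on (d x) Y"
    and "\<And>x y. x \<in> Y \<Longrightarrow> y \<in> Y \<Longrightarrow> f x = f y \<Longrightarrow> d x y \<in> Z"
  shows "card Y \<le> card (f ` Y) * card Z"
proof -
  have fib: "card {x \<in> Y. f x = y} \<le> card Z" if "y \<in> f ` Y" for y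
  proof -
    from that obtain x0 where x0: "x0 \<in> Y" "y = f x0" by blast
    show ?thesis
    proof (rule card_inj_on_le)
      show "inj_on (d x0) {x \<in> Y. f x = y}"
        using assms(3)[OF x0(1)] by (rule inj_on_subset) auto
      show "d x0 ` {x \<in> Y. f x = y} \<subseteq> Z"
        using assms(4) x0 by auto
    qed fact
  qed
  have "card Y = card (\<Union>y\<in>f ` Y. {x \<in> Y. f x = y})"
    by (rule arg_cong[of _ _ card]) auto
  also have "\<dots> \<le> (\<Sum>y\<in>f ` Y. card {x \<in> Y. f x = y})"
    by (rule card_UN_le) (use assms(1) in auto)
  also have "\<dots> \<le> (\<Sum>y\<in>f ` Y. card Z)"
    by (rule sum_mono) (rule fib)
  finally show ?thesis by simp
qed

text \<open>Coefficient families on a basis correspond bijectively to vectors. Dimensions and ranks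
  thus become exponents of cardinalities.\<close>

lemma card_carrier_vectorspace:
  assumes "vectorspace (class_ring :: 'a::{field,finite} ring) V" "finite (carrier V)"
  shows "card (carrier V) = CARD('a) ^ vectorspace.dim (class_ring :: 'a ring) V"
proof -
  interpret vectorspace "class_ring :: 'a ring" V by fact
  \<comment> \<open>The carrier is finite and spans itself.\<close>
  have "fin_dim"
    unfolding fin_dim_def using assms(2)
    using in_own_span[of "carrier V"] span_is_subset2[of "carrier V"] by blast
  then obtain B where B: "finite B" "basis B"
    using finite_basis_exists by blast
  have BV: "B \<subseteq> carrier V" using B(2) unfolding basis_def by blast
  have uniq: "\<exists>!a. a \<in> B \<rightarrow>\<^sub>E carrier class_ring \<and> lincomb a B = v" if "v \<in> carrier V" for v
    using basis_criterion[OF B(1) BV] B(2) that by blast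
  have closed: "lincomb a B \<in> carrier V" if "a \<in> B \<rightarrow>\<^sub>E carrier class_ring" for a
    using that BV by (intro lincomb_closed) auto
  have "bij_betw (\<lambda>a. lincomb a B) (B \<rightarrow>\<^sub>E carrier class_ring) (carrier V)"
    unfolding bij_betw_def
  proof
    show "inj_on (\<lambda>a. lincomb a B) (B \<rightarrow>\<^sub>E carrier class_ring)"
      using uniq closed by (intro inj_onI) metis
    show "(\<lambda>a. lincomb a B) ` (B \<rightarrow>\<^sub>E carrier class_ring) = carrier V"
      using uniq closed by (auto simp: image_iff) metis
  qed
  hence "card (carrier V) = card (B \<rightarrow>\<^sub>E (UNIV :: 'a set))"
    by (simp add: bij_betw_same_card class_ring_simps)
  also have "\<dots> = CARD('a) ^ card B"
    using B(1) by (rule card_PiE_UNIV)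
  also have "card B = dim"
    using dim_basis[OF B] by simp
  finally show ?thesis .
qed

lemma finite_carrier_vec: "finite (carrier_vec n :: 'a::finite vec set)"
  and card_carrier_vec: "card (carrier_vec n :: 'a vec set) = CARD('a) ^ n"
proof -
  have "bij_betw (vec n) (PiE {..<n} (\<lambda>_. UNIV :: 'a set)) (carrier_vec n)"
  proof (rule bij_betwI[where g = "\<lambda>v. restrict (\<lambda>i. v $ i) {..<n}"])
    fix f :: "nat \<Rightarrow> 'a" assume "f \<in> PiE {..<n} (\<lambda>_. UNIV)"
    thus "restrict (\<lambda>i. vec n f $ i) {..<n} = f"
      by (auto simp: fun_eq_iff PiE_iff extensional_def restrict_def)
  qed auto
  note bij = this
  have "finite (PiE {..<n} (\<lambda>_. UNIV :: 'a set))"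
    by (simp add: finite_PiE)
  thus "finite (carrier_vec n :: 'a vec set)"
    using bij_betw_finite[OF bij] by blast
  show "card (carrier_vec n :: 'a vec set) = CARD('a) ^ n"
    using bij_betw_same_card[OF bij] card_PiE_UNIV[of "{..<n}", where 'a = 'a] by simp
qed

lemma dim_mat_subspace:
  fixes C :: "'a::{field,finite} mat set"
  assumes "VectorSpace.subspace class_ring C (module_mat TYPE('a) m n)"
    and "card C = CARD('a) ^ d"
  shows "vectorspace.dim class_ring ((module_mat TYPE('a) m n)\<lparr>carrier := C\<rparr>) = d"
proof -
  interpret vectorspace "class_ring :: 'a ring" "module_mat TYPE('a) m n"
    by (rule matrix_vs)
  have "vectorspace class_ring (module_mat TYPE('a) m n\<lparr>carrier := C\<rparr>)"
    by (rule subspace_is_vs) fact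
  moreover have "finite C"
    using assms(2) one_less_CARD_field[where 'a = 'a] by (intro card_ge_0_finite) simp
  ultimately show ?thesis
    using card_carrier_vectorspace[of "module_mat TYPE('a) m n\<lparr>carrier := C\<rparr>"] assms(2)
      one_less_CARD_field[where 'a = 'a]
    by (simp add: power_inject_exp)
qed

section \<open>Rank estimates by counting\<close>

lemma card_image_mult_mat_vec:
  fixes A :: "'a::{field,finite} mat"
  assumes A: "A \<in> carrier_mat m n"
  shows "card ((\<lambda>x. A *\<^sub>v x) ` carrier_vec n) = CARD('a) ^ vec_space.rank m A"
proof -
  interpret vec_space "TYPE('a)" m .
  have "col_space A = (\<lambda>x. A *\<^sub>v x) ` carrier_vec n"
    using A by (auto simp: col_space_eq[OF A])
  hence im: "span (set (cols A)) = (\<lambda>x. A *\<^sub>v x) ` carrier_vec n"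
    by (simp add: col_space_def)
  have "vectorspace class_ring (span_vs (set (cols A)))"
    using A cols_dim[of A] by (intro subspace_is_vs span_is_subspace) auto
  from card_carrier_vectorspace[OF this] show ?thesis
    by (simp add: im rank_def finite_carrier_vec)
qed

text \<open>Rank-nullity in counting form: \<open>CARD('a) ^ n\<close> is at most the size of the
  image, whose exponent is the rank, times the size of the kernel.\<close>

lemma rank_geI:
  fixes A :: "'a::{field,finite} mat"
  assumes A: "A \<in> carrier_mat m n" and "d \<le> n"
    and ker: "card {x \<in> carrier_vec n. A *\<^sub>v x = 0\<^sub>v m} \<le> CARD('a) ^ (n - d)"
  shows "d \<le> vec_space.rank m A"
proof -
  let ?q = "CARD('a)"
  have "?q ^ n = card (carrier_vec n :: 'a vec set)"
    by (simp add: card_carrier_vec)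
  also have "\<dots> \<le> card ((\<lambda>x. A *\<^sub>v x) ` carrier_vec n) * card {x \<in> carrier_vec n. A *\<^sub>v x = 0\<^sub>v m}"
  proof (rule card_le_card_image_times[where d = "\<lambda>x y. y - x"])
    fix x :: "'a vec" assume x: "x \<in> carrier_vec n"
    show "inj_on (\<lambda>y. y - x) (carrier_vec n)"
    proof (rule inj_onI)
      fix y z :: "'a vec" assume y: "y \<in> carrier_vec n" and z: "z \<in> carrier_vec n" and eq: "y - x = z - x"
      have "y $ i = z $ i" if "i < n" for i
        using arg_cong[OF eq, of "\<lambda>v. v $ i"] x y z that by auto
      thus "y = z" using y z by auto
    qed
  next
    fix x y :: "'a vec" assume x: "x \<in> carrier_vec n" and y: "y \<in> carrier_vec n" and "A *\<^sub>v x = A *\<^sub>v y"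
    hence "A *\<^sub>v (y - x) = 0\<^sub>v m"
      using A by (subst mult_minus_distrib_mat_vec[OF A y x]) auto
    thus "y - x \<in> {x \<in> carrier_vec n. A *\<^sub>v x = 0\<^sub>v m}" using x y by auto
  qed (auto simp: finite_carrier_vec)
  also have "\<dots> \<le> ?q ^ vec_space.rank m A * ?q ^ (n - d)"
    using ker by (simp add: card_image_mult_mat_vec[OF A])
  also have "\<dots> = ?q ^ (vec_space.rank m A + (n - d))"
    by (simp add: power_add)
  finally have "n \<le> vec_space.rank m A + (n - d)"
    using one_less_CARD_field[where 'a = 'a] by simp
  thus ?thesis using \<open>d \<le> n\<close> by simp
qed

text \<open>The rows from \<open>i\<close> on only see the last \<open>s\<close> entries of the
  argument. An image vector is therefore determined by its own first \<open>i\<close> entries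
  together with those \<open>s\<close> entries.\<close>

lemma rank_le_support:
  fixes A :: "'a::{field,finite} mat"
  assumes A: "A \<in> carrier_mat m n" and "s \<le> n"
    and supp: "\<And>a b. a < m \<Longrightarrow> b < n \<Longrightarrow> i \<le> a \<Longrightarrow> b < n - s \<Longrightarrow> A $$ (a, b) = 0"
  shows "vec_space.rank m A \<le> i + s"
proof -
  let ?q = "CARD('a)"
  let ?P = "PiE {..<i} (\<lambda>_. UNIV :: 'a set) \<times> PiE {n - s..<n} (\<lambda>_. UNIV :: 'a set)"
  let ?f = "\<lambda>y x. (restrict (\<lambda>a. y $ a) {..<i}, restrict (\<lambda>b. x $ b) {n - s..<n})"
  let ?g = "\<lambda>(y, x). vec m (\<lambda>a. if a < i then y a else \<Sum>b\<in>{n - s..<n}. A $$ (a, b) * x b)"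
  have fin: "finite ?P" by (auto intro!: finite_PiE)
  have sub: "(\<lambda>x. A *\<^sub>v x) ` carrier_vec n \<subseteq> ?g ` ?P"
  proof
    fix y assume "y \<in> (\<lambda>x. A *\<^sub>v x) ` carrier_vec n"
    then obtain x where x: "x \<in> carrier_vec n" and y: "y = A *\<^sub>v x" by auto
    have "y = ?g (?f y x)"
    proof
      fix a assume "a < dim_vec (?g (?f y x))"
      hence a: "a < m" by simp
      have "y $ a = (\<Sum>b\<in>{n - s..<n}. A $$ (a, b) * x $ b)" if "i \<le> a"
      proof -
        have "y $ a = (\<Sum>b\<in>{0..<n}. A $$ (a, b) * x $ b)"
          using A x a unfolding y by (simp add: scalar_prod_def)
        also have "\<dots> = (\<Sum>b\<in>{n - s..<n}. A $$ (a, b) * x $ b)"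
          by (rule sum.mono_neutral_right) (auto simp: supp a that)
        finally show ?thesis .
      qed
      thus "y $ a = ?g (?f y x) $ a" using a by simp
    qed (use A y in auto)
    moreover have "?f y x \<in> ?P" by auto
    ultimately show "y \<in> ?g ` ?P" by blast
  qed
  have "?q ^ vec_space.rank m A \<le> card (?g ` ?P)"
    unfolding card_image_mult_mat_vec[OF A, symmetric]
    by (rule card_mono) (use sub fin in auto)
  also have "\<dots> \<le> card ?P" by (rule card_image_le) (rule fin)
  also have "\<dots> = ?q ^ (i + s)"
    using \<open>s \<le> n\<close> by (simp add: card_cartesian_product card_PiE_UNIV power_add)
  finally show ?thesis
    using one_less_CARD_field[where 'a = 'a] by simp
qed

section \<open>Dots of the diagram and the bound on the dimension\<close>

lemma card_dots_first_columns:
  assumes "k \<le> length \<gamma>" and "length \<gamma> = k + d"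
  shows "card {(a, b) \<in> dots \<gamma>. 0 \<le> a \<and> b + d < length \<gamma>} = (\<Sum>b<k. \<gamma> ! b)"
proof -
  have "{(a, b) \<in> dots \<gamma>. 0 \<le> a \<and> b + d < length \<gamma>} = (\<lambda>(b, a). (a, b)) ` (SIGMA b:{..<k}. {..<\<gamma> ! b})"
    using assms by (auto simp: dots_def image_iff)
  also have "card \<dots> = card (SIGMA b:{..<k}. {..<\<gamma> ! b})"
    by (rule card_image) (auto simp: inj_on_def)
  finally show ?thesis by simp
qed

lemma finite_dots: "finite (dots \<gamma>)"
proof -
  have "dots \<gamma> \<subseteq> (\<lambda>(b, a). (a, b)) ` (SIGMA b:{..<length \<gamma>}. {..<\<gamma> ! b})"
    by (auto simp: dots_def image_iff)
  thus ?thesis by (rule finite_subset) auto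
qed

text \<open>If \<open>C\<close> had more elements than there are fillings of the \<open>v\<^sub>i\<close> dots, two elements of
  \<open>C\<close> would agree on these dots, and their difference would live in \<open>i\<close> rows and \<open>\<delta> - 1 - i\<close> columns.\<close>
lemma card_code_le_ferrers_v:
  fixes C :: "'a::{field,finite} mat set"
  assumes C: "VectorSpace.subspace class_ring C (module_mat TYPE('a) m n)"
    and dist: "\<And>A. A \<in> C \<Longrightarrow> A \<noteq> 0\<^sub>m m n \<Longrightarrow> \<delta> \<le> vec_space.rank m A"
    and supp: "\<And>A a b. A \<in> C \<Longrightarrow> a < m \<Longrightarrow> b < n \<Longrightarrow> (a, b) \<notin> dots \<gamma> \<Longrightarrow> A $$ (a, b) = 0"
    and len: "length \<gamma> = n" and "i < \<delta>" "\<delta> \<le> n"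
  shows "card C \<le> CARD('a) ^ ferrers_v \<gamma> \<delta> i"
proof -
  define S where "S = {(a, b) \<in> dots \<gamma>. i \<le> a \<and> b + (\<delta> - 1 - i) < length \<gamma>}"
  have S_fin: "finite S"
    using finite_dots[of \<gamma>] unfolding S_def by (rule finite_subset[rotated]) auto
  interpret vectorspace "class_ring :: 'a ring" "module_mat TYPE('a) m n"
    by (rule matrix_vs)
  have sm: "submodule class_ring C (module_mat TYPE('a) m n)"
    using C by (simp add: subspace_def)
  have CM: "C \<subseteq> carrier_mat m n"
    using submodule.subset[OF sm] by (simp add: module_mat_simps)
  have diff: "A - B \<in> C" if "A \<in> C" "B \<in> C" for A B
  proof -
    have "A + (- 1) \<cdot>\<^sub>m B \<in> C"
      using submodule.m_closed[OF sm that(1) submodule.smult_closed[OF sm _ that(2)], of "-1"]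
      by (simp add: module_mat_simps class_ring_simps)
    also have "A + (- 1) \<cdot>\<^sub>m B = A - B"
      using that CM by (intro eq_matI) auto
    finally show ?thesis .
  qed
  have inj: "inj_on (\<lambda>A. restrict (\<lambda>p. A $$ p) S) C"
  proof (rule inj_onI, rule ccontr)
    fix A B assume AB: "A \<in> C" "B \<in> C" and eq: "restrict (\<lambda>p. A $$ p) S = restrict (\<lambda>p. B $$ p) S"
      and ne: "A \<noteq> B"
    have Am: "A \<in> carrier_mat m n" and Bm: "B \<in> carrier_mat m n" using AB CM by auto
    have D: "A - B \<in> C" "A - B \<in> carrier_mat m n" using diff AB CM by auto
    have "A - B \<noteq> 0\<^sub>m m n"
    proof
      assume "A - B = 0\<^sub>m m n"
      have "A = B"
      proof (rule eq_matI)
        fix a b assume "a < dim_row B" "b < dim_col B"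
        thus "A $$ (a, b) = B $$ (a, b)"
          using arg_cong[OF \<open>A - B = 0\<^sub>m m n\<close>, of "\<lambda>M. M $$ (a, b)"] Am Bm by auto
      qed (use Am Bm in auto)
      with ne show False by simp
    qed
    with D dist have "\<delta> \<le> vec_space.rank m (A - B)" by blast
    moreover have "vec_space.rank m (A - B) \<le> i + (\<delta> - 1 - i)"
    proof (rule rank_le_support[OF D(2)])
      fix a b assume ab: "a < m" "b < n" "i \<le> a" "b < n - (\<delta> - 1 - i)"
      show "(A - B) $$ (a, b) = 0"
      proof (cases "(a, b) \<in> dots \<gamma>")
        case True
        hence "(a, b) \<in> S" using ab len by (auto simp: S_def)
        hence "A $$ (a, b) = B $$ (a, b)" using fun_cong[OF eq, of "(a, b)"] by simp
        thus ?thesis using Am Bm ab by simp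
      qed (use supp D(1) ab in blast)
    qed (use \<open>\<delta> \<le> n\<close> in simp)
    ultimately show False using \<open>i < \<delta>\<close> by simp
  qed
  have "card C \<le> card (PiE S (\<lambda>_. UNIV :: 'a set))"
    by (rule card_inj_on_le[OF inj]) (use S_fin in \<open>auto intro!: finite_PiE\<close>)
  also have "\<dots> = CARD('a) ^ ferrers_v \<gamma> \<delta> i"
    using S_fin by (simp add: card_PiE_UNIV ferrers_v_def S_def)
  finally show ?thesis .
qed

text \<open>The matrix in \<open>ex\<close> lives in the last \<open>\<delta>\<close> columns, so
  the distance is attained. The minimum over \<open>i\<close> is reached at 0, where the dots
  counted fill the first \<open>k\<close> columns; for the other \<open>i\<close> the inequality
  comes from the bound on \<open>card C\<close>, applied to the code itself.\<close>

lemma optimal_ferrers_codeI: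
  fixes C :: "'a::{field,finite} mat set"
  assumes C: "VectorSpace.subspace class_ring C (module_mat TYPE('a) m n)"
    and card: "card C = CARD('a) ^ (\<Sum>b<k. \<gamma> ! b)"
    and dist: "\<And>A. A \<in> C \<Longrightarrow> A \<noteq> 0\<^sub>m m n \<Longrightarrow> \<delta> \<le> vec_space.rank m A"
    and ex: "\<exists>A\<in>C. A \<noteq> 0\<^sub>m m n \<and> (\<forall>a<m. \<forall>b<k - 1. A $$ (a, b) = 0)"
    and supp: "\<And>A a b. A \<in> C \<Longrightarrow> a < m \<Longrightarrow> b < n \<Longrightarrow> (a, b) \<notin> dots \<gamma> \<Longrightarrow> A $$ (a, b) = 0"
    and len: "length \<gamma> = n" and "1 \<le> \<delta>" "\<delta> \<le> n" and k: "k = n - \<delta> + 1"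
  shows "optimal_ferrers_code m n \<gamma> (\<Sum>b<k. \<gamma> ! b) \<delta> C"
proof -
  have sm: "submodule class_ring C (module_mat TYPE('a) m n)"
    using C by (simp add: subspace_def)
  have CM: "C \<subseteq> carrier_mat m n"
    using submodule.subset[OF sm] by (simp add: module_mat_simps)
  have "min_rank_distance m n C \<delta>"
    unfolding min_rank_distance_def
  proof (intro conjI ballI impI)
    from ex obtain A where A: "A \<in> C" "A \<noteq> 0\<^sub>m m n" "\<forall>a<m. \<forall>b<k - 1. A $$ (a, b) = 0"
      by blast
    have "vec_space.rank m A \<le> 0 + \<delta>"
      by (rule rank_le_support) (use A CM \<open>\<delta> \<le> n\<close> k in auto)
    with A dist[of A] show "\<exists>A\<in>C. A \<noteq> 0\<^sub>m m n \<and> vec_space.rank m A = \<delta>" by auto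
  qed (rule dist)
  moreover have "(\<Sum>b<k. \<gamma> ! b) = (MIN i\<in>{0..\<delta> - 1}. ferrers_v \<gamma> \<delta> i)"
  proof (rule Min_eqI[symmetric])
    fix y assume "y \<in> ferrers_v \<gamma> \<delta> ` {0..\<delta> - 1}"
    then obtain i where i: "i < \<delta>" and y: "y = ferrers_v \<gamma> \<delta> i"
      using \<open>1 \<le> \<delta>\<close> by (metis One_nat_def Suc_pred atLeastAtMost_iff imageE le_imp_less_Suc less_eq_Suc_le)
    have "card C \<le> CARD('a) ^ y"
      unfolding y by (rule card_code_le_ferrers_v[OF C dist supp len i \<open>\<delta> \<le> n\<close>])
    thus "(\<Sum>b<k. \<gamma> ! b) \<le> y"
      unfolding card using one_less_CARD_field[where 'a = 'a] by simp
  next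
    have "ferrers_v \<gamma> \<delta> 0 = (\<Sum>b<k. \<gamma> ! b)"
      unfolding ferrers_v_def using card_dots_first_columns[of k \<gamma> "\<delta> - 1"] len k \<open>1 \<le> \<delta>\<close> \<open>\<delta> \<le> n\<close>
      by simp
    thus "(\<Sum>b<k. \<gamma> ! b) \<in> ferrers_v \<gamma> \<delta> ` {0..\<delta> - 1}" by force
  qed simp
  ultimately show ?thesis
    unfolding optimal_ferrers_code_def ferrers_code_def
    using C dim_mat_subspace[OF C card] supp by blast
qed

subsection \<open>Linear algebra in the algebraic closure\<close>

text \<open>All extension fields are realised as subsets of the one type
  \<open>'a alg_closure\<close>, a vector space over \<open>'a\<close> through \<open>to_ac\<close>.
  Families indexed by naturals serve as bases, so that initial segments of one family can span a
  whole flag.\<close>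

definition combo :: "nat set \<Rightarrow> (nat \<Rightarrow> 'a::field) \<Rightarrow> (nat \<Rightarrow> 'a alg_closure) \<Rightarrow> 'a alg_closure" where
  "combo I x g = (\<Sum>i\<in>I. to_ac (x i) * g i)"

definition indep :: "nat set \<Rightarrow> (nat \<Rightarrow> 'a::field alg_closure) \<Rightarrow> bool" where
  "indep I g \<longleftrightarrow> (\<forall>x. combo I x g = 0 \<longrightarrow> (\<forall>i\<in>I. x i = 0))"

definition lspan :: "nat set \<Rightarrow> (nat \<Rightarrow> 'a::field alg_closure) \<Rightarrow> 'a alg_closure set" where
  "lspan I g = range (\<lambda>x. combo I x g)"

definition lsubspace :: "'a::field alg_closure set \<Rightarrow> bool" where
  "lsubspace W \<longleftrightarrow> 0 \<in> W \<and> (\<forall>x\<in>W. \<forall>y\<in>W. x + y \<in> W) \<and> (\<forall>c. \<forall>x\<in>W. to_ac c * x \<in> W)"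

lemma combo_add: "combo I (\<lambda>i. x i + y i) g = combo I x g + combo I y g"
  by (simp add: combo_def sum.distrib algebra_simps)

lemma combo_diff: "combo I (\<lambda>i. x i - y i) g = combo I x g - combo I y g"
  by (simp add: combo_def sum_subtractf algebra_simps)

lemma combo_scale: "combo I (\<lambda>i. c * x i) g = to_ac c * combo I x g"
  by (simp add: combo_def sum_distrib_left algebra_simps)

lemma combo_sum: "combo I (\<lambda>i. \<Sum>b\<in>B. c b * x b i) g = (\<Sum>b\<in>B. to_ac (c b) * combo I (x b) g)"
proof -
  have "combo I (\<lambda>i. \<Sum>b\<in>B. c b * x b i) g = (\<Sum>i\<in>I. \<Sum>b\<in>B. to_ac (c b) * (to_ac (x b i) * g i))"
    unfolding combo_def to_ac_sum sum_distrib_right to_ac_mult mult.assoc ..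
  also have "\<dots> = (\<Sum>b\<in>B. \<Sum>i\<in>I. to_ac (c b) * (to_ac (x b i) * g i))"
    by (rule sum.swap)
  finally show ?thesis by (simp add: combo_def sum_distrib_left)
qed

lemma combo_cong:
  "(\<And>i. i \<in> I \<Longrightarrow> x i = y i) \<Longrightarrow> (\<And>i. i \<in> I \<Longrightarrow> g i = h i) \<Longrightarrow> combo I x g = combo I y h"
  unfolding combo_def by (rule sum.cong) auto

lemma indepD: "indep I g \<Longrightarrow> combo I x g = 0 \<Longrightarrow> i \<in> I \<Longrightarrow> x i = 0"
  unfolding indep_def by blast

lemma indep_cong: "(\<And>i. i \<in> I \<Longrightarrow> g i = h i) \<Longrightarrow> indep I g \<longleftrightarrow> indep I h"
  unfolding indep_def using combo_cong[of I] by metis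

lemma lspan_cong: "(\<And>i. i \<in> I \<Longrightarrow> g i = h i) \<Longrightarrow> lspan I g = lspan I h"
  unfolding lspan_def by (metis combo_cong)

lemma lspanI: "combo I x g \<in> lspan I g"
  unfolding lspan_def by blast

lemma lspanE:
  assumes "y \<in> lspan I g" obtains x where "combo I x g = y"
  using assms unfolding lspan_def by blast

lemma lsubspace_lspan: "lsubspace (lspan I g)"
  unfolding lsubspace_def
proof (intro conjI ballI allI)
  show "0 \<in> lspan I g" using lspanI[of I "\<lambda>_. 0" g] by (simp add: combo_def)
next
  fix x y assume "x \<in> lspan I g" "y \<in> lspan I g"
  then obtain a b where "combo I a g = x" "combo I b g = y" by (metis lspanE)
  thus "x + y \<in> lspan I g" using lspanI[of I "\<lambda>i. a i + b i" g] by (simp add: combo_add)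
next
  fix c x assume "x \<in> lspan I g"
  then obtain a where "combo I a g = x" by (rule lspanE)
  thus "to_ac c * x \<in> lspan I g" using lspanI[of I "\<lambda>i. c * a i" g] by (simp add: combo_scale)
qed

lemma lsubspace_zero: "lsubspace W \<Longrightarrow> 0 \<in> W"
  and lsubspace_add: "lsubspace W \<Longrightarrow> x \<in> W \<Longrightarrow> y \<in> W \<Longrightarrow> x + y \<in> W"
  and lsubspace_scale: "lsubspace W \<Longrightarrow> x \<in> W \<Longrightarrow> to_ac c * x \<in> W"
  unfolding lsubspace_def by blast+

lemma lsubspace_uminus: "lsubspace W \<Longrightarrow> x \<in> W \<Longrightarrow> - x \<in> W"
  using lsubspace_scale[of W x "-1"] by simp

lemma lsubspace_diff: "lsubspace W \<Longrightarrow> x \<in> W \<Longrightarrow> y \<in> W \<Longrightarrow> x - y \<in> W"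
  using lsubspace_add[of W x "-y"] lsubspace_uminus[of W y] by simp

lemma lsubspace_sum: "lsubspace W \<Longrightarrow> (\<And>i. i \<in> I \<Longrightarrow> f i \<in> W) \<Longrightarrow> sum f I \<in> W"
  by (induction I rule: infinite_finite_induct) (auto intro: lsubspace_zero lsubspace_add)

lemma lspan_subset: "lsubspace W \<Longrightarrow> (\<And>i. i \<in> I \<Longrightarrow> g i \<in> W) \<Longrightarrow> lspan I g \<subseteq> W"
  unfolding lspan_def combo_def by (auto intro!: lsubspace_sum lsubspace_scale)

lemma lspan_base:
  assumes "finite I" "i \<in> I" shows "g i \<in> lspan I g"
proof -
  have "combo I (\<lambda>j. if j = i then 1 else 0) g = g i"
    using assms by (simp add: combo_def if_distrib[of to_ac] if_distrib[of "\<lambda>x. x * _"] sum.delta cong: if_cong)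
  thus ?thesis by (metis lspanI)
qed

lemma lspan_mono:
  assumes "finite J" "I \<subseteq> J" shows "lspan I g \<subseteq> lspan J g"
  by (rule lspan_subset[OF lsubspace_lspan]) (use assms lspan_base in blast)

lemma finite_lspan: "finite I \<Longrightarrow> finite (lspan I (g :: nat \<Rightarrow> 'a::{field,finite} alg_closure))"
  and card_lspan_le: "finite I \<Longrightarrow> card (lspan I g) \<le> CARD('a) ^ card I"
proof -
  assume I: "finite I"
  have eq: "lspan I g = (\<lambda>x. combo I x g) ` PiE I (\<lambda>_. UNIV)"
  proof
    show "lspan I g \<subseteq> (\<lambda>x. combo I x g) ` PiE I (\<lambda>_. UNIV)"
    proof
      fix y assume "y \<in> lspan I g"
      then obtain x where "combo I x g = y" by (rule lspanE)
      hence "y = combo I (restrict x I) g"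
        using combo_cong[of I x "restrict x I" g g] by simp
      thus "y \<in> (\<lambda>x. combo I x g) ` PiE I (\<lambda>_. UNIV)" by (intro image_eqI[of _ _ "restrict x I"]) auto
    qed
    show "(\<lambda>x. combo I x g) ` PiE I (\<lambda>_. UNIV) \<subseteq> lspan I g"
      by (auto simp: lspan_def)
  qed
  have fin: "finite (PiE I (\<lambda>_. UNIV :: 'a set))" using I by (auto intro!: finite_PiE)
  show "finite (lspan I g)" unfolding eq using fin by simp
  show "card (lspan I g) \<le> CARD('a) ^ card I"
    unfolding eq using card_image_le[OF fin] card_PiE_UNIV[OF I, where 'a = 'a] by metis
qed

lemma card_lspan:
  fixes g :: "nat \<Rightarrow> 'a::{field,finite} alg_closure"
  assumes I: "finite I" and g: "indep I g"
  shows "card (lspan I g) = CARD('a) ^ card I"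
proof (rule antisym[OF card_lspan_le[OF I]])
  have "inj_on (\<lambda>x. combo I x g) (PiE I (\<lambda>_. UNIV))"
  proof (rule inj_onI)
    fix x y assume xy: "x \<in> PiE I (\<lambda>_. UNIV)" "y \<in> PiE I (\<lambda>_. UNIV)" "combo I x g = combo I y g"
    show "x = y"
    proof (rule PiE_ext[OF xy(1,2)])
      fix i assume "i \<in> I"
      thus "x i = y i" using indepD[OF g, of "\<lambda>i. x i - y i" i] xy(3) by (simp add: combo_diff)
    qed
  qed
  hence "card (PiE I (\<lambda>_. UNIV :: 'a set)) \<le> card (lspan I g)"
    by (rule card_inj_on_le) (use finite_lspan[OF I] in \<open>auto simp: lspan_def\<close>)
  thus "CARD('a) ^ card I \<le> card (lspan I g)"
    using card_PiE_UNIV[OF I, where 'a = 'a] by simp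
qed

lemma indep_insert:
  assumes I: "finite I" "i \<notin> I" and g: "indep I g" and v: "v \<notin> lspan I g"
  shows "indep (insert i I) (g(i := v))"
  unfolding indep_def
proof (intro allI impI)
  fix x assume "combo (insert i I) x (g(i := v)) = 0"
  moreover have "combo I x (g(i := v)) = combo I x g"
    using I by (intro combo_cong) auto
  ultimately have eq: "to_ac (x i) * v + combo I x g = 0"
    using I by (simp add: combo_def)
  have xi: "x i = 0"
  proof (rule ccontr)
    assume "x i \<noteq> 0"
    have "v = to_ac (- inverse (x i)) * combo I x g"
    proof -
      have "combo I x g = - (to_ac (x i) * v)" using eq by (simp add: eq_neg_iff_add_eq_0 add.commute)
      thus ?thesis using \<open>x i \<noteq> 0\<close> by simp
    qed
    hence "v \<in> lspan I g" using lsubspace_scale[OF lsubspace_lspan lspanI] by metis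
    with v show False by simp
  qed
  hence "combo I x g = 0" using eq by simp
  thus "\<forall>j\<in>insert i I. x j = 0" using xi indepD[OF g] by auto
qed

section \<open>Bases adapted to a flag\<close>

text \<open>Induction on the missing dimension \<open>N - n\<close>. While \<open>n < N\<close>, the
  span has fewer elements than \<open>W\<close>, so some vector of \<open>W\<close> can be appended;
  at \<open>n = N\<close> equal cardinalities make the span all of \<open>W\<close>.\<close>

lemma extend_indep:
  fixes g :: "nat \<Rightarrow> 'a::{field,finite} alg_closure"
  assumes W: "lsubspace W" "card W = CARD('a) ^ N" and "indep {..<n} g" "lspan {..<n} g \<subseteq> W"
  shows "\<exists>g'. (\<forall>i<n. g' i = g i) \<and> indep {..<N} g' \<and> lspan {..<N} g' = W"
  using assms(3,4)
proof (induction "N - n" arbitrary: n g)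
  case 0
  have fin: "finite W" using W(2) one_less_CARD_field[where 'a = 'a] by (intro card_ge_0_finite) simp
  have c: "card (lspan {..<n} g) = CARD('a) ^ n" using card_lspan[OF _ 0(2)] by simp
  have "n \<le> N" using card_mono[OF fin 0(3)] one_less_CARD_field[where 'a = 'a] by (simp add: c W)
  hence "n = N" using 0 by simp
  thus ?case using card_subset_eq[OF fin 0(3)] c 0(2) W(2) by auto
next
  case (Suc d)
  have fin: "finite W" using W(2) one_less_CARD_field[where 'a = 'a] by (intro card_ge_0_finite) simp
  have c: "card (lspan {..<n} g) = CARD('a) ^ n" using card_lspan[OF _ Suc(3)] by simp
  have "n < N" using Suc(2) by simp
  hence "lspan {..<n} g \<noteq> W" using c W(2) one_less_CARD_field[where 'a = 'a] by (metis nat_neq_iff power_inject_exp)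
  then obtain v where v: "v \<in> W" "v \<notin> lspan {..<n} g" using Suc(4) by blast
  let ?g = "g(n := v)"
  have ind: "indep {..<Suc n} ?g"
    using indep_insert[OF _ _ Suc(3) v(2), of n] by (simp add: lessThan_Suc)
  have "lspan {..<Suc n} ?g \<subseteq> W"
  proof (rule lspan_subset[OF W(1)])
    fix i assume "i \<in> {..<Suc n}"
    thus "?g i \<in> W" using v(1) Suc(4) lspan_base[of "{..<n}" i g] by (auto simp: less_Suc_eq)
  qed
  from Suc(1)[OF _ ind this] \<open>n < N\<close> Suc(2) have "\<exists>g'. (\<forall>i<Suc n. g' i = ?g i) \<and> indep {..<N} g' \<and> lspan {..<N} g' = W"
    by fastforce
  then obtain g' where
    "\<forall>i<Suc n. g' i = ?g i" "indep {..<N} g'" "lspan {..<N} g' = W" by blast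
  thus ?case by (intro exI[of _ g']) auto
qed

text \<open>A basis of one member of the flag is extended to the next without changing its entries,
  so a single family serves all members.\<close>

lemma flag_basis:
  fixes W :: "nat \<Rightarrow> 'a::{field,finite} alg_closure set"
  assumes "\<And>i. i \<le> L \<Longrightarrow> lsubspace (W i)" "\<And>i. i \<le> L \<Longrightarrow> card (W i) = CARD('a) ^ d i"
    and "\<And>i. i < L \<Longrightarrow> W i \<subseteq> W (Suc i)"
  shows "\<exists>g. \<forall>i\<le>L. indep {..<d i} g \<and> lspan {..<d i} g = W i"
  using assms
proof (induction L)
  case 0
  have "indep {..<0} (\<lambda>_. 0 :: 'a alg_closure)" by (simp add: indep_def)
  moreover have "lspan {..<0} (\<lambda>_. 0) \<subseteq> W 0" using lsubspace_zero 0 by (auto simp: lspan_def combo_def)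
  ultimately show ?case using extend_indep[OF 0(1,2)[of 0], of 0 "\<lambda>_. 0"] by auto
next
  case (Suc L)
  then obtain g where g: "\<forall>i\<le>L. indep {..<d i} g \<and> lspan {..<d i} g = W i" by auto
  have mono: "W i \<subseteq> W L" if "i \<le> L" for i
    using that
  proof (induction rule: inc_induct)
    case (step i)
    thus ?case using Suc(4)[of i] by simp
  qed simp
  have "finite (W L)"
    using Suc(3)[of L] one_less_CARD_field[where 'a = 'a] by (intro card_ge_0_finite) simp
  \<comment> \<open>The inclusions order the dimensions, so changes from index \<open>d L\<close> on
    leave the segments that span the smaller members alone.\<close>
  hence d: "d i \<le> d L" if "i \<le> L" for i
    using card_mono[OF _ mono[OF that]] Suc(3)[of i] Suc(3)[of L] that
      one_less_CARD_field[where 'a = 'a] by simp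
  have "lspan {..<d L} g \<subseteq> W (Suc L)" using g Suc(4)[of L] by simp
  from extend_indep[OF Suc(2,3)[of "Suc L"] _ this] g obtain g' where g':
    "\<forall>i<d L. g' i = g i" "indep {..<d (Suc L)} g'" "lspan {..<d (Suc L)} g' = W (Suc L)" by auto
  have "indep {..<d i} g' \<and> lspan {..<d i} g' = W i" if "i \<le> L" for i
  proof -
    have "g' j = g j" if "j \<in> {..<d i}" for j using g'(1) d[OF \<open>i \<le> L\<close>] that by simp
    thus ?thesis using g that indep_cong[of "{..<d i}" g' g] lspan_cong[of "{..<d i}" g' g] \<open>i \<le> L\<close> by metis
  qed
  thus ?case using g'(2,3) by (intro exI[of _ g']) (auto simp: le_Suc_eq)
qed

section \<open>Coordinates with respect to a basis\<close>

text \<open>A choice of coefficients, meaningful only for \<open>y\<close> in the span and at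
  indices below \<open>T\<close>; independence of \<open>g\<close> makes it unique there.\<close>

definition coord :: "nat \<Rightarrow> (nat \<Rightarrow> 'a::field alg_closure) \<Rightarrow> 'a alg_closure \<Rightarrow> nat \<Rightarrow> 'a" where
  "coord T g y = (SOME x. combo {..<T} x g = y)"

lemma combo_coord: "y \<in> lspan {..<T} g \<Longrightarrow> combo {..<T} (coord T g y) g = y"
  unfolding coord_def by (metis (mono_tags, lifting) lspanE someI)

lemma coord_combo:
  assumes "indep {..<T} g" "i < T" shows "coord T g (combo {..<T} x g) i = x i"
proof -
  have "combo {..<T} (\<lambda>i. coord T g (combo {..<T} x g) i - x i) g = 0"
    using combo_coord[OF lspanI, of T g x] by (simp add: combo_diff)
  from indepD[OF assms(1) this, of i] assms(2) show ?thesis by simp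
qed

lemma coord_sum:
  assumes "indep {..<T} g" "i < T" "\<And>b. b \<in> B \<Longrightarrow> y b \<in> lspan {..<T} g"
  shows "coord T g (\<Sum>b\<in>B. to_ac (c b) * y b) i = (\<Sum>b\<in>B. c b * coord T g (y b) i)"
proof -
  have "(\<Sum>b\<in>B. to_ac (c b) * y b) = combo {..<T} (\<lambda>i. \<Sum>b\<in>B. c b * coord T g (y b) i) g"
    unfolding combo_sum by (rule sum.cong) (simp_all add: combo_coord assms(3))
  thus ?thesis using coord_combo[OF assms(1,2)] by simp
qed

lemma coord_add:
  assumes "indep {..<T} g" "i < T" "y \<in> lspan {..<T} g" "z \<in> lspan {..<T} g"
  shows "coord T g (y + z) i = coord T g y i + coord T g z i"
  using coord_sum[OF assms(1,2), of "{False, True}" "\<lambda>b. if b then z else y" "\<lambda>_. 1"] assms(3,4) by auto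

lemma coord_scale:
  assumes "indep {..<T} g" "i < T" "y \<in> lspan {..<T} g"
  shows "coord T g (to_ac c * y) i = c * coord T g y i"
  using coord_sum[OF assms(1,2), of "{0::nat}" "\<lambda>_. y" "\<lambda>_. c"] assms(3) by auto

lemma coord_eq_0:
  assumes "indep {..<T} g" "y \<in> lspan {..<s} g" "s \<le> i" "i < T"
  shows "coord T g y i = 0"
proof -
  obtain x where x: "combo {..<s} x g = y" using assms(2) by (rule lspanE)
  have "combo {..<s} x g = combo {..<T} (\<lambda>i. if i < s then x i else 0) g"
    unfolding combo_def by (rule sum.mono_neutral_cong_left) (use assms in auto)
  thus ?thesis using coord_combo[OF assms(1,4), of "\<lambda>i. if i < s then x i else 0"] x assms(3) by simp
qed

lemma coord_eqD:
  assumes "y \<in> lspan {..<T} g" "\<And>i. i < T \<Longrightarrow> coord T g y i = 0"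
  shows "y = 0"
  using combo_coord[OF assms(1)] assms(2) by (simp add: combo_def)

section \<open>Finite subfields of the algebraic closure\<close>

definition fixed_field :: "nat \<Rightarrow> 'a::{field,finite} alg_closure set" where
  "fixed_field t = {x. x ^ (CARD('a) ^ t) = x}"

lemma prime_CHAR_finite: "Factorial_Ring.prime CHAR('a::{field,finite})"
  by (rule prime_CHAR_semidom) (rule finite_imp_CHAR_pos, simp)

lemma CARD_power_CHAR:
  assumes "primepow CARD('a::{field,finite})"
  obtains e where "CARD('a) = CHAR('a) ^ e"
proof -
  obtain p e where pe: "Factorial_Ring.prime p" "CARD('a) = p ^ e"
    using assms unfolding primepow_def by blast
  have "CHAR('a) dvd p ^ e" using CHAR_dvd_CARD[where 'a = 'a] pe(2) by simp
  hence "CHAR('a) dvd p" using prime_CHAR_finite prime_dvd_power by blast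
  hence "CHAR('a) = p" using pe(1) prime_CHAR_finite primes_dvd_imp_eq by blast
  thus ?thesis using that pe by blast
qed

lemma frobenius_add:
  fixes x y :: "'a::{field,finite} alg_closure"
  assumes "primepow CARD('a)"
  shows "(x + y) ^ (CARD('a) ^ t) = x ^ (CARD('a) ^ t) + y ^ (CARD('a) ^ t)"
proof -
  obtain e where e: "CARD('a) = CHAR('a) ^ e" using CARD_power_CHAR[OF assms] .
  show ?thesis
    by (rule freshmans_dream'[where n = "e * t"]) (auto simp: e prime_CHAR_finite power_mult)
qed

text \<open>Multiplication by a nonzero \<open>c\<close> permutes the nonzero elements; comparing
  their products before and after gives \<open>c ^ (CARD('a) - 1) = 1\<close>.\<close>

lemma finite_field_power_CARD:
  fixes c :: "'a::{field,finite}"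
  shows "c ^ CARD('a) = c"
proof (cases "c = 0")
  case False
  have "(\<Prod>y\<in>UNIV-{0}. c * y) = (\<Prod>y\<in>UNIV-{0}. y)"
    by (rule prod.reindex_bij_witness[of _ "\<lambda>y. y / c" "\<lambda>y. c * y"]) (use False in auto)
  hence "c ^ (CARD('a) - 1) = 1" by (simp add: prod.distrib card_Diff_singleton)
  thus ?thesis by (metis finite_UNIV_card_ge_0 finite_class.finite_UNIV mult.right_neutral power_eq_if gr_implies_not0)
qed simp

lemma to_ac_power_CARD: "to_ac (c :: 'a::{field,finite}) ^ (CARD('a) ^ t) = to_ac c"
  by (induction t) (simp_all add: power_mult finite_field_power_CARD flip: to_ac_power)

lemma to_ac_in_fixed_field: "to_ac c \<in> fixed_field t"
  by (simp add: fixed_field_def to_ac_power_CARD)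

lemma fixed_field_mult: "x \<in> fixed_field t \<Longrightarrow> y \<in> fixed_field t \<Longrightarrow> x * y \<in> fixed_field t"
  by (simp add: fixed_field_def power_mult_distrib)

lemma fixed_field_inverse: "x \<in> fixed_field t \<Longrightarrow> inverse x \<in> fixed_field t"
  by (simp add: fixed_field_def power_inverse)

lemma fixed_field_power: "x \<in> fixed_field t \<Longrightarrow> x ^ n \<in> fixed_field t"
  by (simp add: fixed_field_def) (metis power_mult mult.commute)

lemma lsubspace_fixed_field:
  assumes "primepow CARD('a::{field,finite})"
  shows "lsubspace (fixed_field t :: 'a alg_closure set)"
  unfolding lsubspace_def
  by (auto simp: fixed_field_mult to_ac_in_fixed_field)
    (auto simp: fixed_field_def frobenius_add[OF assms])

lemma fixed_field_subset:
  assumes "s dvd t" shows "fixed_field s \<subseteq> (fixed_field t :: 'a::{field,finite} alg_closure set)"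
proof
  fix x :: "'a alg_closure" assume x: "x \<in> fixed_field s"
  obtain j where "t = s * j" using assms by (elim dvdE)
  moreover have "x ^ (CARD('a) ^ (s * j)) = x" for j
    using x by (induction j) (simp_all add: fixed_field_def power_add power_mult)
  ultimately show "x \<in> fixed_field t" by (simp add: fixed_field_def)
qed

text \<open>The polynomial \<open>P\<close> splits over the closure, and its derivative is the
  constant -1 because the characteristic divides \<open>n\<close>. It therefore has \<open>n\<close>
  distinct roots.\<close>

lemma card_fixed_field:
  assumes "primepow CARD('a::{field,finite})" "1 \<le> t"
  shows "card (fixed_field t :: 'a alg_closure set) = CARD('a) ^ t"
proof -
  define n where "n = CARD('a) ^ t"
  define P :: "'a alg_closure poly" where "P = Polynomial.monom 1 n + [:0, -1:]"
  have "1 < n" unfolding n_def using one_less_CARD_field[where 'a = 'a] assms(2) by (intro one_less_power) auto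
  hence deg: "Polynomial.degree P = n"
    unfolding P_def by (subst degree_add_eq_left) (auto simp: degree_monom_eq)
  have "CHAR('a) dvd n"
    unfolding n_def using CHAR_dvd_CARD[where 'a = 'a] assms(2) by (simp add: dvd_power_same dvd_trans)
  hence "(of_nat n :: 'a alg_closure) = 0"
    by (simp add: of_nat_eq_0_iff_char_dvd)
  hence pd: "pderiv P = [:-1:]"
    by (simp add: P_def pderiv_add pderiv_monom pderiv_pCons)
  have "P \<noteq> 0" using deg \<open>1 < n\<close> by auto
  then obtain A where A: "size A = n" "P = smult (Polynomial.lead_coeff P) (\<Prod>x\<in>#A. [:-x, 1:])"
    using alg_closed_imp_factorization[of P] deg by metis
  have roots: "set_mset A = fixed_field t"
  proof -
    have "x \<in># A \<longleftrightarrow> poly P x = 0" for x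
      using \<open>P \<noteq> 0\<close> by (subst A(2)) (auto simp: poly_prod_mset prod_mset_zero_iff)
    thus ?thesis
      by (auto simp: fixed_field_def P_def poly_monom n_def)
  qed
  have "count A x = 1" if "x \<in># A" for x
  proof (rule ccontr)
    assume "count A x \<noteq> 1"
    with that have "2 \<le> count A x" by (metis One_nat_def Suc_1 Suc_leI count_greater_zero_iff le_neq_implies_less)
    then obtain B where "A = {#x, x#} + B"
      by (metis count_le_replicate_mset_subset_eq mset_subset_eq_exists_conv numeral_2_eq_2 replicate_mset_0 replicate_mset_Suc)
    hence "P = [:-x, 1:] * ([:-x, 1:] * smult (Polynomial.lead_coeff P) (\<Prod>x\<in>#B. [:-x, 1:]))"
      using A(2) by (simp add: mult_ac)
    then obtain R where R: "P = [:-x, 1:] * ([:-x, 1:] * R)" by blast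
    have "poly (pderiv P) x = 0" by (subst R, subst pderiv_mult) simp
    thus False by (simp add: pd)
  qed
  hence "size A = card (set_mset A)" by (simp add: size_multiset_overloaded_eq)
  thus ?thesis using A(1) roots n_def by simp
qed

lemma fixed_field_1_eq:
  assumes "primepow CARD('a::{field,finite})"
  shows "fixed_field 1 = (range to_ac :: 'a alg_closure set)"
proof -
  have "card (fixed_field 1 :: 'a alg_closure set) = CARD('a)" using card_fixed_field[OF assms, of 1] by simp
  moreover have "card (range to_ac :: 'a alg_closure set) = CARD('a)" by (rule card_image) (rule inj_to_ac)
  moreover have "finite (fixed_field 1 :: 'a alg_closure set)"
    using calculation(1) by (intro card_ge_0_finite) simp
  ultimately show ?thesis using card_subset_eq[of "fixed_field 1" "range to_ac :: 'a alg_closure set"] to_ac_in_fixed_field by auto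
qed

text \<open>Induction on \<open>w\<close>: a space that is still too small misses some
  \<open>z\<close> of the big field, and adjoining the \<open>fixed_field s\<close>-multiples of
  \<open>z\<close> raises the dimension by \<open>s\<close>. The closure under multiplication by
  \<open>fixed_field s\<close> is what forward substitution uses later.\<close>

lemma intermediate_subspace:
  assumes pp: "primepow CARD('a::{field,finite})" and "1 \<le> s" "1 \<le> w" "w \<le> c"
  shows "\<exists>V :: 'a alg_closure set. lsubspace V \<and> card V = CARD('a) ^ (w * s) \<and>
    fixed_field s \<subseteq> V \<and> V \<subseteq> fixed_field (c * s) \<and> (\<forall>x\<in>fixed_field s. \<forall>v\<in>V. x * v \<in> V)"
  using assms(3,4)
proof (induction w rule: nat_induct_at_least)
  case base
  show ?case
    by (intro exI[of _ "fixed_field s"])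
      (use lsubspace_fixed_field[OF pp] card_fixed_field[OF pp \<open>1 \<le> s\<close>] fixed_field_mult
        fixed_field_subset[of s "c * s"] in auto)
next
  case (Suc w)
  let ?q = "CARD('a)" and ?F = "fixed_field s :: 'a alg_closure set" and ?E = "fixed_field (c * s) :: 'a alg_closure set"
  have q: "1 < ?q" by (rule one_less_CARD_field)
  from Suc obtain V :: "'a alg_closure set" where V: "lsubspace V" "card V = ?q ^ (w * s)"
    "?F \<subseteq> V" "V \<subseteq> ?E" "\<And>x v. x \<in> ?F \<Longrightarrow> v \<in> V \<Longrightarrow> x * v \<in> V" by auto
  have "w * s \<noteq> c * s" using Suc \<open>1 \<le> s\<close> by simp
  moreover have cE: "card ?E = ?q ^ (c * s)" using card_fixed_field[OF pp, of "c * s"] Suc \<open>1 \<le> s\<close> by simp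
  ultimately have "V \<noteq> ?E" using V(2) q by (metis power_inject_exp)
  then obtain z where z: "z \<in> ?E" "z \<notin> V" using V(4) by blast
  let ?f = "\<lambda>(v, x). v + x * z"
  let ?V = "?f ` (V \<times> ?F)"
  have lF: "lsubspace ?F" and lE: "lsubspace ?E" using lsubspace_fixed_field[OF pp] by auto
  have FE: "?F \<subseteq> ?E" by (rule fixed_field_subset) simp
  have inj: "inj_on ?f (V \<times> ?F)"
  proof (rule inj_onI, clarify)
    fix v x v' x' assume h: "v \<in> V" "x \<in> ?F" "v' \<in> V" "x' \<in> ?F" "v + x * z = v' + x' * z"
    \<comment> \<open>If the coefficients of \<open>z\<close> differed, their difference could be
      inverted in the small field, which would put \<open>z\<close> into \<open>V\<close>.\<close>
    have "x = x'"
    proof (rule ccontr)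
      assume "x \<noteq> x'"
      hence "z = inverse (x - x') * (v' - v)" using h(5) by (simp add: field_simps)
      moreover have "inverse (x - x') \<in> ?F" using h lF by (intro fixed_field_inverse lsubspace_diff)
      moreover have "v' - v \<in> V" using h V(1) by (intro lsubspace_diff)
      ultimately show False using V(5) z(2) by metis
    qed
    thus "v = v' \<and> x = x'" using h(5) by simp
  qed
  show ?case
  proof (intro exI[of _ ?V] conjI ballI)
    show "lsubspace ?V"
      unfolding lsubspace_def
    proof (intro conjI ballI allI)
      show "0 \<in> ?V" using lsubspace_zero[OF V(1)] lsubspace_zero[OF lF] by force
    next
      fix a b assume "a \<in> ?V" "b \<in> ?V"
      then obtain v x v' x' where h: "v \<in> V" "x \<in> ?F" "v' \<in> V" "x' \<in> ?F" "a = v + x * z" "b = v' + x' * z" by auto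
      hence "a + b = ?f (v + v', x + x')" by (simp add: algebra_simps)
      moreover have "(v + v', x + x') \<in> V \<times> ?F" using h V(1) lF lsubspace_add by auto
      ultimately show "a + b \<in> ?V" by blast
    next
      fix c a assume "a \<in> ?V"
      then obtain v x where h: "v \<in> V" "x \<in> ?F" "a = v + x * z" by auto
      hence "to_ac c * a = ?f (to_ac c * v, to_ac c * x)" by (simp add: algebra_simps)
      moreover have "(to_ac c * v, to_ac c * x) \<in> V \<times> ?F" using h V(1) lF lsubspace_scale by auto
      ultimately show "to_ac c * a \<in> ?V" by blast
    qed
    show "card ?V = ?q ^ (Suc w * s)"
      using card_image[OF inj] V(2) card_fixed_field[OF pp \<open>1 \<le> s\<close>]
      by (simp add: card_cartesian_product power_add mult.commute)
    show "?F \<subseteq> ?V" using V(3) lsubspace_zero[OF lF] by force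
    show "?V \<subseteq> ?E"
      using V(4) FE z(1) lE by (auto intro!: lsubspace_add fixed_field_mult)
    fix y a assume y: "y \<in> ?F" and "a \<in> ?V"
    then obtain v x where h: "v \<in> V" "x \<in> ?F" "a = v + x * z" by auto
    hence "y * a = ?f (y * v, y * x)" by (simp add: algebra_simps)
    moreover have "(y * v, y * x) \<in> V \<times> ?F" using h y V(5) fixed_field_mult by auto
    ultimately show "y * a \<in> ?V" by blast
  qed
qed

subsection \<open>Evaluation points of Newton type\<close>

text \<open>With \<open>q = CARD('a)\<close> this is the value at \<open>x\<close> of the
  \<open>q\<close>-polynomial \<open>X^q - c^(q-1) X\<close>. For nonzero \<open>c\<close> its
  kernel is the line over the base field spanned by \<open>c\<close>.\<close>

definition newton_step :: "'a::{field,finite} alg_closure \<Rightarrow> 'a alg_closure \<Rightarrow> 'a alg_closure" where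
  "newton_step c x = x ^ CARD('a) - c ^ (CARD('a) - 1) * x"

lemma newton_step_0 [simp]: "newton_step c 0 = 0"
  by (simp add: newton_step_def)

lemma newton_step_self [simp]: "newton_step c (c :: 'a::{field,finite} alg_closure) = 0"
proof -
  have "Suc (CARD('a) - 1) = CARD('a)" by simp
  hence "c ^ (CARD('a) - 1) * c = c ^ CARD('a)" by (metis power_Suc2)
  thus ?thesis by (simp add: newton_step_def)
qed

lemma newton_step_combo:
  fixes g :: "nat \<Rightarrow> 'a::{field,finite} alg_closure"
  assumes pp: "primepow CARD('a)"
  shows "newton_step c (combo I x g) = combo I x (\<lambda>b. newton_step c (g b))"
proof -
  have add: "newton_step c (y + z) = newton_step c y + newton_step c z" for y z :: "'a alg_closure"
    using frobenius_add[OF pp, of y z 1] by (simp add: newton_step_def algebra_simps)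
  have scale: "newton_step c (to_ac k * y) = to_ac k * newton_step c y" for k and y :: "'a alg_closure"
    using to_ac_power_CARD[of k 1] by (simp add: newton_step_def power_mult_distrib algebra_simps)
  show ?thesis
    unfolding combo_def by (induction I rule: infinite_finite_induct) (simp_all add: add scale)
qed

text \<open>The quotient \<open>y / c\<close> is fixed by the Frobenius map, hence lies in the base
  field.\<close>

lemma newton_step_eq_0D:
  fixes c y :: "'a::{field,finite} alg_closure"
  assumes pp: "primepow CARD('a)" and "c \<noteq> 0" and "newton_step c y = 0"
  obtains k where "y = to_ac k * c"
proof -
  have "y ^ CARD('a) = c ^ (CARD('a) - 1) * y" using assms(3) by (simp add: newton_step_def)
  moreover have "c ^ CARD('a) = c ^ (CARD('a) - 1) * c"
    by (metis newton_step_self newton_step_def right_minus_eq)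
  ultimately have "(y / c) ^ CARD('a) = y / c"
    using \<open>c \<noteq> 0\<close> by (simp add: power_divide)
  hence "y / c \<in> fixed_field 1" by (simp add: fixed_field_def)
  then obtain k where "y / c = to_ac k" unfolding fixed_field_1_eq[OF pp] by blast
  hence "y = to_ac k * c" using \<open>c \<noteq> 0\<close> by (simp add: field_simps)
  thus ?thesis by (rule that)
qed

lemma newton_step_in_fixed_field:
  fixes c x :: "'a::{field,finite} alg_closure"
  assumes "primepow CARD('a)" "c \<in> fixed_field t" "x \<in> fixed_field t"
  shows "newton_step c x \<in> fixed_field t"
  unfolding newton_step_def
  using assms by (intro lsubspace_diff[OF lsubspace_fixed_field] fixed_field_mult fixed_field_power)

text \<open>Row \<open>j\<close> of \<open>pts\<close> holds the values at the evaluation points of a monic \<open>q\<close>-polynomial of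
  \<open>q\<close>-degree \<open>j\<close> which annihilates the first \<open>j\<close> points; one fresh point enters
  with every row, so that row \<open>j\<close> is linearly independent on the window \<open>{j..<s + j}\<close>.\<close>
locale newton_points =
  fixes g :: "nat \<Rightarrow> 'a::{field,finite} alg_closure" and s T :: nat
  assumes pp: "primepow CARD('a)" and s: "1 \<le> s" "s \<le> T"
    and g_fixed: "\<And>b. b < s \<Longrightarrow> g b \<in> fixed_field T"
    and g_indep: "indep {..<s} g"
begin

primrec pts :: "nat \<Rightarrow> nat \<Rightarrow> 'a alg_closure" where
  "pts 0 = (\<lambda>b. if b < s then g b else 0)"
| "pts (Suc j) = (\<lambda>b. newton_step (pts j j) (pts j b))
     (s + j := SOME v. v \<in> fixed_field T \<and>
        v \<notin> lspan {Suc j..<s + j} (\<lambda>b. newton_step (pts j j) (pts j b)))"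

lemma pts_Suc: "b \<noteq> s + j \<Longrightarrow> pts (Suc j) b = newton_step (pts j j) (pts j b)"
  by simp

declare pts.simps(2) [simp del]

lemma pts_eq_0: "b < j \<or> s + j \<le> b \<Longrightarrow> pts j b = 0"
proof (induction j arbitrary: b)
  case (Suc j)
  hence "b \<noteq> s + j" using s by auto
  thus ?case using Suc by (cases "b = j") (auto simp: pts_Suc)
qed simp

text \<open>A Newton step only kills multiples of the pivot \<open>pts j j\<close>, so the other
  \<open>s - 1\<close> points of the window stay independent. As \<open>s - 1 < T\<close>, their
  span cannot exhaust the field of size \<open>CARD('a) ^ T\<close>, which leaves room for the fresh
  point.\<close>

lemma pts_inv: "(\<forall>b. pts j b \<in> fixed_field T) \<and> indep {j..<s + j} (pts j)"
proof (induction j)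
  case 0
  have "indep {0..<s} (pts 0) \<longleftrightarrow> indep {0..<s} g" by (rule indep_cong) simp
  thus ?case using g_indep g_fixed lsubspace_zero[OF lsubspace_fixed_field[OF pp]]
    by (simp add: lessThan_atLeast0)
next
  case (Suc j)
  let ?h = "\<lambda>b. newton_step (pts j j) (pts j b)"
  have indj: "indep {j..<s + j} (pts j)" using Suc by simp
  have j: "j \<in> {j..<s + j}" using s by simp
  have nz: "pts j j \<noteq> 0"
  proof
    assume "pts j j = 0"
    hence "combo {j..<s + j} (\<lambda>b. if b = j then 1 else 0) (pts j) = 0"
      by (auto simp: combo_def intro!: sum.neutral)
    from indepD[OF indj this j] show False by simp
  qed
  have h_fixed: "?h b \<in> fixed_field T" for b
    using Suc newton_step_in_fixed_field[OF pp] by blast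
  have h_indep: "indep {Suc j..<s + j} ?h"
    unfolding indep_def
  proof (intro allI impI)
    fix x assume "combo {Suc j..<s + j} x ?h = 0"
    hence "newton_step (pts j j) (combo {Suc j..<s + j} x (pts j)) = 0"
      by (simp add: newton_step_combo[OF pp])
    then obtain k where k: "combo {Suc j..<s + j} x (pts j) = to_ac k * pts j j"
      using newton_step_eq_0D[OF pp nz] by blast
    \<comment> \<open>Bringing the multiple of the pivot to the other side gives a relation among
      all points of row \<open>j\<close>, so its coefficients vanish.\<close>
    have "{j..<s + j} = insert j {Suc j..<s + j}" using s by auto
    hence "combo {j..<s + j} (x(j := - k)) (pts j) = - to_ac k * pts j j + combo {Suc j..<s + j} (x(j := - k)) (pts j)"
      by (simp add: combo_def)
    also have "combo {Suc j..<s + j} (x(j := - k)) (pts j) = combo {Suc j..<s + j} x (pts j)"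
      by (rule combo_cong) auto
    finally have "combo {j..<s + j} (x(j := - k)) (pts j) = 0"
      unfolding k by (simp del: fun_upd_apply)
    note zero = indepD[OF indj this]
    show "\<forall>b\<in>{Suc j..<s + j}. x b = 0"
    proof
      fix b assume "b \<in> {Suc j..<s + j}"
      thus "x b = 0" using zero[of b] by simp
    qed
  qed
  have "card (lspan {Suc j..<s + j} ?h) < card (fixed_field T :: 'a alg_closure set)"
    using card_lspan[OF _ h_indep] card_fixed_field[OF pp, of T] s one_less_CARD_field[where 'a = 'a]
    by simp
  hence "\<not> fixed_field T \<subseteq> lspan {Suc j..<s + j} ?h"
    using card_mono[OF finite_lspan] by (metis finite_atLeastLessThan not_less)
  hence "\<exists>v. v \<in> fixed_field T \<and> v \<notin> lspan {Suc j..<s + j} ?h" by blast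
  from someI_ex[OF this] have new: "pts (Suc j) (s + j) \<in> fixed_field T"
    "pts (Suc j) (s + j) \<notin> lspan {Suc j..<s + j} ?h"
    by (simp_all add: pts.simps(2))
  have eq: "pts (Suc j) = ?h(s + j := pts (Suc j) (s + j))" by (simp add: pts.simps(2))
  have "indep (insert (s + j) {Suc j..<s + j}) (pts (Suc j))"
    by (subst eq) (rule indep_insert[OF _ _ h_indep new(2)], auto)
  moreover have "insert (s + j) {Suc j..<s + j} = {Suc j..<s + Suc j}" using s by auto
  moreover have "pts (Suc j) b \<in> fixed_field T" for b
    using new(1) h_fixed pts_Suc by (cases "b = s + j") auto
  ultimately show ?case by simp
qed

lemma pts_fixed: "pts j b \<in> fixed_field T" and indep_pts: "indep {j..<s + j} (pts j)"
  using pts_inv by blast+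

lemma pts_diag: "pts j j \<noteq> 0"
proof
  assume "pts j j = 0"
  hence "combo {j..<s + j} (\<lambda>b. if b = j then 1 else 0) (pts j) = 0"
    by (auto simp: combo_def intro!: sum.neutral)
  from indepD[OF indep_pts this, of j] s show False by simp
qed

text \<open>For \<open>b < j\<close> the entry is 0. Otherwise it arises from \<open>g b\<close> by
  Newton steps with pivots of smaller index, so only \<open>g 0\<close> to \<open>g b\<close>
  enter.\<close>

lemma pts_subfield:
  assumes "b < s" "\<And>c. c \<le> b \<Longrightarrow> g c \<in> fixed_field t"
  shows "pts j b \<in> fixed_field t"
  using assms
proof (induction j arbitrary: b)
  case (Suc j)
  show ?case
  proof (cases "j \<ge> b")
    case True
    thus ?thesis using pts_eq_0[of b "Suc j"] lsubspace_zero[OF lsubspace_fixed_field[OF pp]] by simp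
  next
    case False
    hence "pts j j \<in> fixed_field t" "pts j b \<in> fixed_field t" using Suc by auto
    thus ?thesis using newton_step_in_fixed_field[OF pp] Suc(2) by (simp add: pts_Suc)
  qed
qed simp

section \<open>Words and Newton interpolation\<close>

text \<open>The coefficients \<open>a\<close> refer to the Newton basis: for \<open>b < s\<close>
  this is the value at \<open>g b\<close> of a \<open>q\<close>-polynomial of
  \<open>q\<close>-degree less than \<open>k\<close>. Later positions use the fresh points.\<close>

definition word :: "nat \<Rightarrow> (nat \<Rightarrow> 'a alg_closure) \<Rightarrow> nat \<Rightarrow> 'a alg_closure" where
  "word k a b = (\<Sum>i<k. a i * pts i b)"

lemma word_add: "word k (\<lambda>i. a i + c i) b = word k a b + word k c b"
  by (simp add: word_def sum.distrib algebra_simps)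

lemma word_scale: "word k (\<lambda>i. y * a i) b = y * word k a b"
  by (simp add: word_def sum_distrib_left algebra_simps)

lemma word_triangular:
  assumes "b < k" shows "word k a b = a b * pts b b + (\<Sum>i<b. a i * pts i b)"
proof -
  have "word k a b = (\<Sum>i\<in>insert b {..<b}. a i * pts i b)"
    unfolding word_def by (rule sum.mono_neutral_right) (use assms pts_eq_0 in auto)
  thus ?thesis by simp
qed

text \<open>The system is triangular with nonzero diagonal \<open>pts j j\<close>, so the
  coefficient with index \<open>j\<close> can be solved for without disturbing earlier
  values.\<close>

lemma word_interpolate:
  "j \<le> k \<Longrightarrow> \<exists>a. (\<forall>i\<ge>j. a i = 0) \<and> (\<forall>b<j. word k a b = u b)"
proof (induction j)
  case 0
  show ?case by (intro exI[of _ "\<lambda>_. 0"]) simp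
next
  case (Suc j)
  then obtain a where a: "\<forall>i\<ge>j. a i = 0" "\<forall>b<j. word k a b = u b" by auto
  define a' where "a' = a(j := inverse (pts j j) * (u j - (\<Sum>i<j. a i * pts i j)))"
  have "word k a' b = u b" if "b < Suc j" for b
  proof -
    have "(\<Sum>i<b. a' i * pts i b) = (\<Sum>i<b. a i * pts i b)"
      by (rule sum.cong) (use that in \<open>auto simp: a'_def\<close>)
    hence "word k a' b = a' b * pts b b + (\<Sum>i<b. a i * pts i b)"
      using that Suc(2) by (simp add: word_triangular)
    thus ?thesis
      using that a(2) Suc(2) pts_diag[of j] word_triangular[of b k a] by (cases "b = j") (auto simp: a'_def mult.commute[of "inverse _"] mult.assoc)
  qed
  moreover have "\<forall>i\<ge>Suc j. a' i = 0" using a(1) by (simp add: a'_def)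
  ultimately show ?case by blast
qed

text \<open>Forward substitution: a coefficient arises from values in \<open>V\<close> by
  subtracting multiples by entries of \<open>pts\<close> and dividing by a pivot, and
  \<open>V\<close> is closed under multiplication by the field containing these entries. A
  restriction on the free values thus passes to the coefficients and from them to the other
  values.\<close>

lemma word_coefficients_in:
  assumes V: "lsubspace V" "\<And>x v. x \<in> fixed_field t \<Longrightarrow> v \<in> V \<Longrightarrow> x * v \<in> V"
    and P: "\<And>i b. i \<le> b \<Longrightarrow> b < j \<Longrightarrow> pts i b \<in> fixed_field t"
    and "j \<le> k" and W: "\<And>b. b < j \<Longrightarrow> word k a b \<in> V"
  shows "i < j \<Longrightarrow> a i \<in> V"
proof (induction i rule: less_induct)
  case (less i)
  have "a i * pts i i = word k a i - (\<Sum>l<i. pts l i * a l)"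
    using word_triangular[of i k a] less(2) \<open>j \<le> k\<close> by (simp add: mult.commute)
  hence "a i = inverse (pts i i) * (word k a i - (\<Sum>l<i. pts l i * a l))"
    using pts_diag[of i] by (simp add: field_simps)
  also have "\<dots> \<in> V"
    using less P W
    by (intro V(2) fixed_field_inverse lsubspace_diff[OF V(1)] lsubspace_sum[OF V(1)]) auto
  finally show ?case .
qed

lemma word_coefficients_eq_0:
  assumes "j \<le> k" "\<And>b. b < j \<Longrightarrow> word k a b = 0" "i < j"
  shows "a i = 0"
  using word_coefficients_in[of "{0}" T j k a i] assms pts_fixed by (simp add: lsubspace_def)

section \<open>Zeros of the cofactor\<close>

text \<open>The composition of the \<open>d\<close> Newton steps that lead from row \<open>j\<close>
  to row \<open>j + d\<close>, written as a polynomial.\<close>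

primrec npoly :: "nat \<Rightarrow> nat \<Rightarrow> 'a alg_closure poly" where
  "npoly j 0 = [:0, 1:]"
| "npoly j (Suc d) = npoly j d ^ CARD('a) -
     Polynomial.smult (pts (j + d) (j + d) ^ (CARD('a) - 1)) (npoly j d)"

lemma degree_npoly: "Polynomial.degree (npoly j d) = CARD('a) ^ d"
proof (induction d)
  case (Suc d)
  let ?q = "CARD('a)"
  have q: "1 < ?q" by (rule one_less_CARD_field)
  have pos: "0 < Polynomial.degree (npoly j d)" using Suc q by simp
  hence "Polynomial.degree (npoly j d ^ ?q) = ?q ^ Suc d"
    by (subst degree_power_eq) (use Suc in auto)
  moreover have "Polynomial.degree (Polynomial.smult c (npoly j d)) < ?q ^ Suc d" for c
    using degree_smult_le[of c "npoly j d"] pos Suc q by (simp add: le_less_trans)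
  ultimately show ?case
    unfolding npoly.simps(2) diff_conv_add_uminus
    by (subst degree_add_eq_left) (simp_all only: degree_minus)
qed simp

text \<open>Points that are fresh after row \<open>j\<close> have index at least
  \<open>s + j\<close>. Inside the window each row is therefore the Newton step of the previous
  one.\<close>

lemma poly_npoly:
  "poly (npoly j d) (combo {j..<s + j} x (pts j)) = combo {j..<s + j} x (pts (j + d))"
proof (induction d)
  case (Suc d)
  have "poly (npoly j (Suc d)) (combo {j..<s + j} x (pts j)) =
      newton_step (pts (j + d) (j + d)) (combo {j..<s + j} x (pts (j + d)))"
    by (simp add: Suc newton_step_def)
  also have "\<dots> = combo {j..<s + j} x (pts (j + Suc d))"
    unfolding newton_step_combo[OF pp] by (rule combo_cong) (auto simp: pts_Suc)
  finally show ?case .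
qed simp

text \<open>As the first \<open>j\<close> coefficients vanish, the word arises on the window from
  row \<open>j\<close> by applying \<open>Q\<close>, of degree at most
  \<open>CARD('a) ^ (k - 1 - j)\<close>. Row \<open>j\<close> is independent there, so distinct
  kernel vectors give distinct zeros of \<open>Q\<close>.\<close>

lemma card_word_kernel_le:
  assumes a0: "\<And>i. i < j \<Longrightarrow> a i = 0" and i0: "i0 < k" "a i0 \<noteq> 0"
  shows "card {x \<in> PiE {j..<s + j} (\<lambda>_. UNIV). combo {j..<s + j} x (word k a) = 0} \<le> CARD('a) ^ (k - 1 - j)"
proof -
  let ?J = "{j..<s + j}" and ?q = "CARD('a)"
  have q: "1 < ?q" by (rule one_less_CARD_field)
  define Q where "Q = (\<Sum>i\<in>{j..<k}. Polynomial.smult (a i) (npoly j (i - j)))"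
  have eval: "poly Q (combo ?J x (pts j)) = combo ?J x (word k a)" for x
  proof -
    have "combo ?J x (word k a) = (\<Sum>b\<in>?J. \<Sum>i<k. a i * (to_ac (x b) * pts i b))"
      unfolding combo_def word_def sum_distrib_left by (intro sum.cong refl) (simp add: mult_ac)
    also have "\<dots> = (\<Sum>i<k. \<Sum>b\<in>?J. a i * (to_ac (x b) * pts i b))"
      by (rule sum.swap)
    also have "\<dots> = (\<Sum>i<k. a i * combo ?J x (pts i))"
      by (simp add: combo_def sum_distrib_left)
    also have "\<dots> = (\<Sum>i\<in>{j..<k}. a i * combo ?J x (pts i))"
      by (rule sum.mono_neutral_right) (auto simp: a0 not_le)
    also have "\<dots> = (\<Sum>i\<in>{j..<k}. a i * poly (npoly j (i - j)) (combo ?J x (pts j)))"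
      by (rule sum.cong) (auto simp: poly_npoly)
    also have "\<dots> = poly Q (combo ?J x (pts j))" by (simp add: Q_def poly_sum)
    finally show ?thesis by simp
  qed
  \<comment> \<open>The summands of \<open>Q\<close> have distinct degrees, so its coefficient at
    \<open>?q ^ (M - j)\<close> comes from the summand \<open>M\<close> alone. This gives
    \<open>Q \<noteq> 0\<close>.\<close>
  define M where "M = Max {i. i < k \<and> a i \<noteq> 0}"
  have "M \<in> {i. i < k \<and> a i \<noteq> 0}"
    unfolding M_def by (rule Max_in) (use i0 in auto)
  hence M: "M < k" "a M \<noteq> 0" by auto
  have M_max: "i \<le> M" if "i < k" "a i \<noteq> 0" for i
    unfolding M_def by (rule Max_ge) (use that in auto)
  have "j \<le> M" using a0 M(2) not_le by blast
  have "Polynomial.coeff Q (?q ^ (M - j)) = (\<Sum>i\<in>{j..<k}. a i * Polynomial.coeff (npoly j (i - j)) (?q ^ (M - j)))"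
    by (simp add: Q_def coeff_sum)
  also have "\<dots> = (\<Sum>i\<in>{M}. a i * Polynomial.coeff (npoly j (i - j)) (?q ^ (M - j)))"
  proof (rule sum.mono_neutral_right)
    show "\<forall>i\<in>{j..<k} - {M}. a i * Polynomial.coeff (npoly j (i - j)) (?q ^ (M - j)) = 0"
    proof
      fix i assume i: "i \<in> {j..<k} - {M}"
      show "a i * Polynomial.coeff (npoly j (i - j)) (?q ^ (M - j)) = 0"
      proof (cases "i < M")
        case True
        hence "Polynomial.degree (npoly j (i - j)) < ?q ^ (M - j)"
          using i q by (auto simp: degree_npoly intro!: power_strict_increasing)
        thus ?thesis by (simp add: coeff_eq_0)
      next
        case False
        thus ?thesis using M_max[of i] i by force
      qed
    qed
  qed (use M \<open>j \<le> M\<close> in auto)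
  also have "\<dots> \<noteq> 0"
  proof -
    have "Polynomial.coeff (npoly j (M - j)) (?q ^ (M - j)) \<noteq> 0"
      using degree_npoly[of j "M - j"] q leading_coeff_0_iff[of "npoly j (M - j)"]
      by (metis degree_0 power_not_zero not_one_less_zero)
    thus ?thesis using M(2) by simp
  qed
  finally have Q0: "Q \<noteq> 0" by auto
  have "Polynomial.degree Q \<le> ?q ^ (k - 1 - j)"
    unfolding Q_def
  proof (rule degree_sum_le)
    fix i assume "i \<in> {j..<k}"
    hence "?q ^ (i - j) \<le> ?q ^ (k - 1 - j)" using q by (intro power_increasing) auto
    thus "Polynomial.degree (Polynomial.smult (a i) (npoly j (i - j))) \<le> ?q ^ (k - 1 - j)"
      using degree_smult_le[of "a i" "npoly j (i - j)"] by (simp add: degree_npoly)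
  qed simp
  moreover have "card {x \<in> PiE ?J (\<lambda>_. UNIV). combo ?J x (word k a) = 0} \<le> card {z. poly Q z = 0}"
  proof (rule card_inj_on_le)
    show "inj_on (\<lambda>x. combo ?J x (pts j)) {x \<in> PiE ?J (\<lambda>_. UNIV). combo ?J x (word k a) = 0}"
    proof (rule inj_onI)
      fix x y assume xy: "x \<in> {x \<in> PiE ?J (\<lambda>_. UNIV). combo ?J x (word k a) = 0}"
        "y \<in> {x \<in> PiE ?J (\<lambda>_. UNIV). combo ?J x (word k a) = 0}" "combo ?J x (pts j) = combo ?J y (pts j)"
      show "x = y"
      proof (rule PiE_ext)
        fix i assume "i \<in> ?J"
        thus "x i = y i"
          using indepD[OF indep_pts, of j "\<lambda>i. x i - y i" i] xy(3) by (simp add: combo_diff)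
      qed (use xy(1,2) in blast)+
    qed
    show "(\<lambda>x. combo ?J x (pts j)) ` {x \<in> PiE ?J (\<lambda>_. UNIV). combo ?J x (word k a) = 0} \<subseteq> {z. poly Q z = 0}"
      by (auto simp: eval)
    show "finite {z. poly Q z = 0}" using Q0 by (rule poly_roots_finite)
  qed
  ultimately show ?thesis using card_poly_roots_bound[OF Q0] by linarith
qed

end

subsection \<open>The code\<close>

lemma indep_subset:
  assumes "indep J g" "I \<subseteq> J" "finite J" shows "indep I g"
  unfolding indep_def
proof (intro allI impI ballI)
  fix x i assume "combo I x g = 0" "i \<in> I"
  moreover have "combo I x g = combo J (\<lambda>b. if b \<in> I then x b else 0) g"
    unfolding combo_def by (rule sum.mono_neutral_cong_left) (use assms in auto)
  ultimately show "x i = 0"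
    using indepD[OF assms(1), of "\<lambda>b. if b \<in> I then x b else 0" i] assms(2) by auto
qed

text \<open>Of the chain of subfields only its effect enters here. It is packed into
  \<open>middle_columns\<close>: free values that fit into the first \<open>k\<close> columns force
  the values before position \<open>s\<close> to fit into theirs.\<close>

locale staircase_code = newton_points g s T
  for g :: "nat \<Rightarrow> 'a::{field,finite} alg_closure" and s T +
  fixes \<gamma> :: "nat list" and m r k :: nat
  assumes basis: "indep {..<T} g" "lspan {..<T} g = fixed_field T"
    and diagram: "ferrers_diagram m (s + r) \<gamma>"
    and k: "1 \<le> k" "k \<le> s"
    and first_columns: "\<And>b. b < k \<Longrightarrow> \<gamma> ! b \<le> T"
    and middle_columns: "\<And>a b. k \<le> b \<Longrightarrow> b < s \<Longrightarrow>
      (\<And>i. i < k \<Longrightarrow> word k a i \<in> lspan {..<\<gamma> ! i} g) \<Longrightarrow> word k a b \<in> lspan {..<\<gamma> ! b} g"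
    and last_columns: "\<And>h. h < r \<Longrightarrow> T + (\<Sum>j=0..h. \<gamma> ! j) \<le> \<gamma> ! (s + h)"
begin

abbreviation crd :: "'a alg_closure \<Rightarrow> nat \<Rightarrow> 'a" where
  "crd \<equiv> coord T g"

lemma \<gamma>_mono: "i \<le> j \<Longrightarrow> j < s + r \<Longrightarrow> \<gamma> ! i \<le> \<gamma> ! j"
  using diagram unfolding ferrers_diagram_def by (simp add: sorted_iff_nth_mono)

lemma \<gamma>_le_m: "b < s + r \<Longrightarrow> \<gamma> ! b \<le> m"
  using diagram \<gamma>_mono[of b "s + r - 1"] unfolding ferrers_diagram_def by simp

lemma \<gamma>_pos: "b < s + r \<Longrightarrow> 1 \<le> \<gamma> ! b"
  using diagram \<gamma>_mono[of 0 b] unfolding ferrers_diagram_def by simp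

lemma length_\<gamma>: "length \<gamma> = s + r"
  using diagram unfolding ferrers_diagram_def by simp

section \<open>Messages and the layout of codewords\<close>

text \<open>The diagram restricts the values of the word, not its coefficients. Zero coefficients
  from \<open>k\<close> on make a message determined by its first \<open>k\<close> values.\<close>

definition messages :: "(nat \<Rightarrow> 'a alg_closure) set" where
  "messages = {a. (\<forall>i\<ge>k. a i = 0) \<and> (\<forall>b<k. word k a b \<in> lspan {..<\<gamma> ! b} g)}"

text \<open>From row \<open>T\<close> on, column \<open>s + h\<close> is a stack of blocks, one for
  each \<open>j \<le> h\<close>, with \<open>j = h\<close> on top. Block \<open>j\<close> has height
  \<open>\<gamma> ! j\<close> and starts at offset \<open>height (Suc j) h\<close>; it holds a copy
  of the value at \<open>j\<close>, or zeros if \<open>j \<ge> k\<close>.\<close>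

definition height :: "nat \<Rightarrow> nat \<Rightarrow> nat" where
  "height j h = (\<Sum>i\<in>{j..h}. \<gamma> ! i)"

definition lower :: "(nat \<Rightarrow> 'a alg_closure) \<Rightarrow> nat \<Rightarrow> nat \<Rightarrow> 'a" where
  "lower a h y = (\<Sum>j\<in>{..h} \<inter> {..<k}.
     if height (Suc j) h \<le> y \<and> y < height j h then crd (word k a j) (y - height (Suc j) h) else 0)"

definition entry :: "(nat \<Rightarrow> 'a alg_closure) \<Rightarrow> nat \<Rightarrow> nat \<Rightarrow> 'a" where
  "entry a i b = (if i < T then crd (word k a b) i else if s \<le> b then lower a (b - s) (i - T) else 0)"

definition codeword :: "(nat \<Rightarrow> 'a alg_closure) \<Rightarrow> 'a mat" where
  "codeword a = mat m (s + r) (\<lambda>(i, b). entry a i b)"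

lemma height_rec: "j \<le> h \<Longrightarrow> height j h = \<gamma> ! j + height (Suc j) h"
  unfolding height_def by (rule sum.atLeast_Suc_atMost)

lemma height_antimono: "i \<le> j \<Longrightarrow> height j h \<le> height i h"
  unfolding height_def by (rule sum_mono2) auto

lemma height_mono: "h \<le> h' \<Longrightarrow> height j h \<le> height j h'"
  unfolding height_def by (rule sum_mono2) auto

text \<open>Column heights increase, so moving every index up by one cannot shorten a stack. This
  makes the staircase: the blocks with index at least \<open>j\<close> in column
  \<open>s + h\<close> end before block \<open>j\<close> of column \<open>s + h + 1\<close>
  begins.\<close>

lemma height_shift:
  assumes "Suc h < s + r" shows "height j h \<le> height (Suc j) (Suc h)"
proof -
  have "height (Suc j) (Suc h) = (\<Sum>i\<in>{j..h}. \<gamma> ! Suc i)"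
    unfolding height_def by (rule sum.shift_bounds_cl_Suc_ivl)
  thus ?thesis unfolding height_def using assms by (auto intro!: sum_mono \<gamma>_mono)
qed

lemma messages_zero: "(\<lambda>_. 0) \<in> messages"
  using lsubspace_zero[OF lsubspace_lspan] by (auto simp: messages_def word_def)

lemma messages_add: "a \<in> messages \<Longrightarrow> c \<in> messages \<Longrightarrow> (\<lambda>i. a i + c i) \<in> messages"
  by (auto simp: messages_def word_add intro!: lsubspace_add[OF lsubspace_lspan])

lemma messages_scale: "a \<in> messages \<Longrightarrow> (\<lambda>i. to_ac y * a i) \<in> messages"
  by (auto simp: messages_def word_scale intro!: lsubspace_scale[OF lsubspace_lspan])

lemma first_lspan: "a \<in> messages \<Longrightarrow> b < k \<Longrightarrow> word k a b \<in> lspan {..<T} g"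
  using lspan_mono[of "{..<T}" "{..<\<gamma> ! b}" g] first_columns[of b] by (auto simp: messages_def)

text \<open>Forward substitution in \<open>fixed_field T\<close> puts the coefficients into this
  field, which contains all points, the fresh ones included.\<close>

lemma word_lspan:
  assumes "a \<in> messages" shows "word k a b \<in> lspan {..<T} g"
proof -
  have "a i \<in> fixed_field T" if "i < k" for i
    by (rule word_coefficients_in[where t = T and j = k and k = k])
      (use lsubspace_fixed_field[OF pp] fixed_field_mult pts_fixed first_lspan[OF assms] that basis(2) in auto)
  thus ?thesis
    unfolding basis(2) word_def
    by (intro lsubspace_sum[OF lsubspace_fixed_field[OF pp]] fixed_field_mult pts_fixed) auto
qed

lemma word_support:
  assumes "a \<in> messages" "b < s + r" shows "word k a b \<in> lspan {..<\<gamma> ! b} g"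
proof (cases "b < k")
  case True
  thus ?thesis using assms(1) by (simp add: messages_def)
next
  case False
  show ?thesis
  proof (cases "b < s")
    case True
    show ?thesis by (rule middle_columns) (use True False assms in \<open>auto simp: messages_def\<close>)
  next
    case False
    hence "b - s < r" using assms(2) by simp
    hence "T \<le> \<gamma> ! b" using last_columns[of "b - s"] False by simp
    thus ?thesis using lspan_mono[of "{..<\<gamma> ! b}" "{..<T}" g] word_lspan[OF assms(1)] by auto
  qed
qed

lemma crd_word_eq_0:
  assumes "a \<in> messages" "b < s + r" "\<gamma> ! b \<le> i" "i < T"
  shows "crd (word k a b) i = 0"
  using coord_eq_0[OF basis(1) word_support] assms by blast

lemma lower_add:
  assumes "a \<in> messages" "c \<in> messages"
  shows "lower (\<lambda>i. a i + c i) h y = lower a h y + lower c h y"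
proof -
  have "crd (word k (\<lambda>i. a i + c i) j) (y - height (Suc j) h) =
      crd (word k a j) (y - height (Suc j) h) + crd (word k c j) (y - height (Suc j) h)"
    if "j \<le> h" "j < k" "height (Suc j) h \<le> y" "y < height j h" for j
  proof -
    \<comment> \<open>Additivity of \<open>crd\<close> is available at indices below
      \<open>T\<close>; a block of height \<open>\<gamma> ! j \<le> T\<close> does not go beyond
      them.\<close>
    have "y - height (Suc j) h < T" using that first_columns[of j] height_rec[of j h] by simp
    thus ?thesis by (simp add: word_add coord_add[OF basis(1)] word_lspan assms)
  qed
  thus ?thesis unfolding lower_def sum.distrib[symmetric] by (intro sum.cong) auto
qed

lemma lower_scale:
  assumes "a \<in> messages"
  shows "lower (\<lambda>i. to_ac z * a i) h y = z * lower a h y"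
proof -
  have "crd (word k (\<lambda>i. to_ac z * a i) j) (y - height (Suc j) h) = z * crd (word k a j) (y - height (Suc j) h)"
    if "j \<le> h" "j < k" "height (Suc j) h \<le> y" "y < height j h" for j
  proof -
    have "y - height (Suc j) h < T" using that first_columns[of j] height_rec[of j h] by simp
    thus ?thesis by (simp add: word_scale coord_scale[OF basis(1)] word_lspan assms)
  qed
  thus ?thesis unfolding lower_def sum_distrib_left by (intro sum.cong) auto
qed

lemma codeword_carrier: "codeword a \<in> carrier_mat m (s + r)"
  by (simp add: codeword_def)

lemma codeword_add:
  assumes "a \<in> messages" "c \<in> messages"
  shows "codeword (\<lambda>i. a i + c i) = codeword a + codeword c"
  by (rule eq_matI)
    (auto simp: codeword_def entry_def lower_add assms word_add coord_add[OF basis(1)] word_lspan)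

lemma codeword_scale:
  assumes "a \<in> messages"
  shows "codeword (\<lambda>i. to_ac z * a i) = z \<cdot>\<^sub>m codeword a"
  by (rule eq_matI)
    (auto simp: codeword_def entry_def lower_scale assms word_scale coord_scale[OF basis(1)] word_lspan)

lemma codeword_zero: "codeword (\<lambda>_. 0) = 0\<^sub>m m (s + r)"
proof -
  have "codeword (\<lambda>_. 0) = 0 \<cdot>\<^sub>m codeword (\<lambda>_. 0)"
    using codeword_scale[OF messages_zero, of 0] by simp
  also have "\<dots> = 0\<^sub>m m (s + r)"
    using codeword_carrier[of "\<lambda>_. 0"] by (intro eq_matI) auto
  finally show ?thesis .
qed

lemma subspace_code: "VectorSpace.subspace class_ring (codeword ` messages) (module_mat TYPE('a) m (s + r))"
proof -
  have "LinearCombinations.submodule class_ring (codeword ` messages) (module_mat TYPE('a) m (s + r))"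
  proof (rule LinearCombinations.submodule.intro)
    show "module (class_ring :: 'a ring) (module_mat TYPE('a) m (s + r))"
      using matrix_vs by (rule vectorspace.axioms(1))
    show "codeword ` messages \<subseteq> carrier (module_mat TYPE('a) m (s + r))"
      by (auto simp: module_mat_simps codeword_carrier)
    show "\<zero>\<^bsub>module_mat TYPE('a) m (s + r)\<^esub> \<in> codeword ` messages"
      using codeword_zero messages_zero by (auto simp: module_mat_simps image_iff intro!: bexI)
  next
    fix A B assume "A \<in> codeword ` messages" "B \<in> codeword ` messages"
    thus "A \<oplus>\<^bsub>module_mat TYPE('a) m (s + r)\<^esub> B \<in> codeword ` messages"
      by (auto simp: module_mat_simps codeword_add[symmetric] messages_add)
  next
    fix z A assume "A \<in> codeword ` messages"
    thus "z \<odot>\<^bsub>module_mat TYPE('a) m (s + r)\<^esub> A \<in> codeword ` messages"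
      by (auto simp: module_mat_simps codeword_scale[symmetric] messages_scale)
  qed
  thus ?thesis using matrix_vs by (simp add: VectorSpace.subspace_def)
qed

section \<open>Kernels of codewords\<close>

text \<open>Blocks with index below \<open>j\<close> copy zero values, and all other blocks lie at
  offsets less than \<open>height j h\<close>.\<close>

lemma lower_eq_0:
  assumes "\<And>i. i < j \<Longrightarrow> word k a i = 0" "height j h \<le> y"
  shows "lower a h y = 0"
  unfolding lower_def
proof (rule sum.neutral, intro ballI)
  fix i assume i: "i \<in> {..h} \<inter> {..<k}"
  show "(if height (Suc i) h \<le> y \<and> y < height i h then crd (word k a i) (y - height (Suc i) h) else 0) = 0"
  proof (cases "i < j")
    case True
    \<comment> \<open>\<open>crd\<close> is defined by choice, so its value at 0 takes an argument:
      0 lies in the span of the empty family.\<close>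
    have "crd 0 (y - height (Suc i) h) = 0" if "height (Suc i) h \<le> y" "y < height i h"
    proof (rule coord_eq_0[OF basis(1) lsubspace_zero[OF lsubspace_lspan, of "{..<0}"]])
      show "y - height (Suc i) h < T" using that i first_columns[of i] height_rec[of i h] by auto
    qed simp
    thus ?thesis using assms(1)[OF True] by auto
  next
    case False
    thus ?thesis using height_antimono[of j i h] assms(2) by auto
  qed
qed

text \<open>The blocks of one column are disjoint, so at an offset inside block \<open>j\<close> a
  single summand survives.\<close>

lemma lower_pivot:
  assumes "\<And>i. i < j \<Longrightarrow> word k a i = 0" and j: "j \<le> h" "j < k" and y: "y < \<gamma> ! j"
  shows "lower a h (height (Suc j) h + y) = crd (word k a j) y"
proof -
  let ?f = "\<lambda>i. if height (Suc i) h \<le> height (Suc j) h + y \<and> height (Suc j) h + y < height i h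
    then crd (word k a i) (height (Suc j) h + y - height (Suc i) h) else 0"
  have "lower a h (height (Suc j) h + y) = (\<Sum>i\<in>{j}. ?f i)"
    unfolding lower_def
  proof (rule sum.mono_neutral_right)
    show "\<forall>i\<in>{..h} \<inter> {..<k} - {j}. ?f i = 0"
    proof
      fix i assume i: "i \<in> {..h} \<inter> {..<k} - {j}"
      show "?f i = 0"
      proof (cases "i < j")
        case True
        hence "height j h \<le> height (Suc i) h" by (intro height_antimono) simp
        thus ?thesis using y height_rec[OF j(1)] by simp
      next
        case False
        hence "height i h \<le> height (Suc j) h" using i by (intro height_antimono) auto
        thus ?thesis by simp
      qed
    qed
  qed (use j in auto)
  thus ?thesis using y height_rec[OF j(1)] by simp
qed

text \<open>If \<open>j\<close> is the first nonzero entry of the message, the lower parts of the columns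
  \<open>s + j, \<dots>, s + r - 1\<close> form a staircase, which forces these coordinates of a kernel
  vector to vanish.\<close>
lemma kernel_last_coordinates:
  assumes a: "a \<in> messages" "\<And>i. i < j \<Longrightarrow> word k a i = 0" "word k a j \<noteq> 0" "j < k"
    and ker: "\<And>i. i < m \<Longrightarrow> (\<Sum>b<s + r. entry a i b * x b) = 0"
  shows "j \<le> h \<Longrightarrow> h < r \<Longrightarrow> x (s + h) = 0"
\<comment> \<open>The last columns are cleared from right to left: once the entries of
  \<open>x\<close> beyond \<open>s + h\<close> vanish, one row settles
  \<open>x (s + h)\<close>.\<close>
proof (induction "r - h" arbitrary: h rule: less_induct)
  case less
  obtain y where "y < T" and y0: "crd (word k a j) y \<noteq> 0"
    using coord_eqD[OF word_lspan[OF a(1)], of j] a(3) by blast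
  hence y: "y < \<gamma> ! j"
    using crd_word_eq_0[OF a(1), of j y] k a(4) by (meson leI less_le_trans trans_less_add1)
  \<comment> \<open>Row \<open>T + i\<close> meets block \<open>j\<close> of column
    \<open>s + h\<close> in a nonzero coordinate. To its left, the first \<open>s\<close> columns
    are zero from row \<open>T\<close> on; in the others the blocks from index \<open>j\<close> on
    have already ended, and those before \<open>j\<close> hold zeros.\<close>
  define i where "i = height (Suc j) h + y"
  have "i < height j h" using y height_rec[OF less(2)] by (simp add: i_def)
  also have "height j h \<le> height 0 h" by (rule height_antimono) simp
  finally have "T + i < m"
    using last_columns[OF less(3)] \<gamma>_le_m[of "s + h"] less(3) by (simp add: height_def)
  hence "0 = (\<Sum>b<s + r. entry a (T + i) b * x b)" using ker by simp
  also have "\<dots> = (\<Sum>b\<in>{s + h}. entry a (T + i) b * x b)"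
  proof (rule sum.mono_neutral_right)
    show "\<forall>b\<in>{..<s + r} - {s + h}. entry a (T + i) b * x b = 0"
    proof
      fix b assume b: "b \<in> {..<s + r} - {s + h}"
      consider "b < s" | "s + h < b" | "s \<le> b" "b < s + h" using b by fastforce
      thus "entry a (T + i) b * x b = 0"
      proof cases
        case 1
        thus ?thesis by (simp add: entry_def)
      next
        case 2
        have "x (s + (b - s)) = 0" by (rule less(1)) (use 2 b less in auto)
        thus ?thesis using 2 by simp
      next
        case 3
        have "height j (b - s) \<le> height (Suc j) (Suc (b - s))"
          by (rule height_shift) (use b 3 s in auto)
        also have "\<dots> \<le> height (Suc j) h" by (rule height_mono) (use 3 in auto)
        also have "\<dots> \<le> i" by (simp add: i_def)
        finally have "lower a (b - s) i = 0" by (rule lower_eq_0[rotated]) (rule a(2))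
        thus ?thesis using 3 by (simp add: entry_def)
      qed
    qed
  qed (use less(3) in auto)
  also have "\<dots> = crd (word k a j) y * x (s + h)"
    using lower_pivot[of j a h y] a less(2) y by (simp add: entry_def i_def)
  finally show ?case using y0 by simp
qed

text \<open>The first \<open>T\<close> rows of the kernel condition are the coordinates of this sum.
  If \<open>m < T\<close>, the missing rows belong to coordinates that vanish because no column is
  higher than \<open>m\<close>.\<close>

lemma kernel_relation:
  assumes a: "a \<in> messages"
    and ker: "\<And>i. i < m \<Longrightarrow> (\<Sum>b<s + r. entry a i b * x b) = 0"
  shows "(\<Sum>b<s + r. to_ac (x b) * word k a b) = 0"
proof (rule coord_eqD)
  show "(\<Sum>b<s + r. to_ac (x b) * word k a b) \<in> lspan {..<T} g"
    by (intro lsubspace_sum lsubspace_scale lsubspace_lspan word_lspan a)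
  fix i assume i: "i < T"
  have "crd (\<Sum>b<s + r. to_ac (x b) * word k a b) i = (\<Sum>b<s + r. x b * crd (word k a b) i)"
    by (rule coord_sum[OF basis(1) i]) (rule word_lspan[OF a])
  also have "\<dots> = 0"
  proof (cases "i < m")
    case True
    thus ?thesis using ker[OF True] i by (simp add: entry_def mult.commute)
  next
    case False
    thus ?thesis using crd_word_eq_0[OF a _ _ i] \<gamma>_le_m
      by (intro sum.neutral) (metis le_trans lessThan_iff mult_zero_right not_le)
  qed
  finally show "crd (\<Sum>b<s + r. to_ac (x b) * word k a b) i = 0" .
qed

text \<open>Let \<open>j\<close> be the first index with a nonzero coefficient. The first
  \<open>j\<close> entries of a kernel vector are counted freely, those in the window
  \<open>{j..<s + j}\<close> form a relation among values of the word, and the later ones vanish.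
  The exponents \<open>j\<close> and \<open>k - 1 - j\<close> add up to
  \<open>k - 1\<close>.\<close>

lemma card_kernel_codeword_le:
  assumes a: "a \<in> messages" and ne: "a \<noteq> (\<lambda>_. 0)"
  shows "card {x \<in> carrier_vec (s + r). codeword a *\<^sub>v x = 0\<^sub>v m} \<le> CARD('a) ^ (k - 1)"
proof -
  let ?q = "CARD('a)" and ?n = "s + r"
  define j where "j = (LEAST i. a i \<noteq> 0)"
  have aj: "a j \<noteq> 0" unfolding j_def by (rule LeastI_ex) (use ne in auto)
  have a0: "a i = 0" if "i < j" for i using not_less_Least[OF that[unfolded j_def]] by simp
  have jk: "j < k" using a aj by (auto simp: messages_def not_le[symmetric])
  have w0: "word k a i = 0" if "i < j" for i
    using word_triangular[of i k a] a0 that jk by simp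
  have wj: "word k a j \<noteq> 0"
    using word_triangular[OF jk, of a] a0 aj pts_diag[of j] by simp
  let ?J = "{j..<s + j}"
  let ?K = "{x \<in> carrier_vec ?n. codeword a *\<^sub>v x = 0\<^sub>v m}"
  let ?L = "{y \<in> PiE ?J (\<lambda>_. UNIV). combo ?J y (word k a) = 0}"
  \<comment> \<open>For \<open>j > r\<close> the window runs past the last column; the vector is
    padded with zeros there.\<close>
  let ?f = "\<lambda>x :: 'a vec. (restrict (\<lambda>b. x $ b) {..<j}, restrict (\<lambda>b. if b < ?n then x $ b else 0) ?J)"
  have ker: "(\<Sum>b<?n. entry a i b * x $ b) = 0" if "x \<in> ?K" "i < m" for x i
  proof -
    have "x \<in> carrier_vec ?n" using that(1) by simp
    hence "(codeword a *\<^sub>v x) $ i = (\<Sum>b<?n. entry a i b * x $ b)"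
      using that(2) by (simp add: codeword_def scalar_prod_def lessThan_atLeast0)
    moreover have "(codeword a *\<^sub>v x) $ i = 0\<^sub>v m $ i" using that(1) by simp
    ultimately show ?thesis using that(2) by simp
  qed
  have last: "x $ b = 0" if "x \<in> ?K" "s + j \<le> b" "b < ?n" for x b
    using kernel_last_coordinates[OF a w0 wj jk ker[OF that(1)], of "b - s"] that(2,3) by simp
  have "card ?K \<le> card (PiE {..<j} (\<lambda>_. UNIV :: 'a set) \<times> ?L)"
  proof (rule card_inj_on_le)
    show "inj_on ?f ?K"
    proof (rule inj_onI)
      fix x y assume x: "x \<in> ?K" and y: "y \<in> ?K" and eq: "?f x = ?f y"
      show "x = y"
      proof (rule eq_vecI)
        fix b assume "b < dim_vec y"
        moreover have "y \<in> carrier_vec ?n" using y by simp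
        ultimately have b: "b < ?n" by simp
        consider "b < j" | "b \<in> ?J" | "s + j \<le> b" by fastforce
        thus "x $ b = y $ b"
        proof cases
          case 1
          thus ?thesis using fun_cong[OF arg_cong[OF eq, of fst], of b] by simp
        next
          case 2
          thus ?thesis using fun_cong[OF arg_cong[OF eq, of snd], of b] b by simp
        next
          case 3
          thus ?thesis using last x y b by simp
        qed
      qed (use x y in auto)
    qed
    show "?f ` ?K \<subseteq> PiE {..<j} (\<lambda>_. UNIV) \<times> ?L"
    proof (intro image_subsetI)
      fix x assume x: "x \<in> ?K"
      have "combo ?J (\<lambda>b. if b < ?n then x $ b else 0) (word k a) = (\<Sum>b\<in>{j..<min ?n (s + j)}. to_ac (x $ b) * word k a b)"
        unfolding combo_def by (rule sum.mono_neutral_cong_right) auto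
      also have "\<dots> = (\<Sum>b<?n. to_ac (x $ b) * word k a b)"
      proof (rule sum.mono_neutral_left)
        show "\<forall>b\<in>{..<?n} - {j..<min ?n (s + j)}. to_ac (x $ b) * word k a b = 0"
        proof
          fix b assume b: "b \<in> {..<?n} - {j..<min ?n (s + j)}"
          hence "b < j \<or> s + j \<le> b" by auto
          thus "to_ac (x $ b) * word k a b = 0" using w0 last[OF x, of b] b by auto
        qed
      qed auto
      also have "\<dots> = 0" by (rule kernel_relation[OF a ker[OF x]])
      finally have "combo ?J (restrict (\<lambda>b. if b < ?n then x $ b else 0) ?J) (word k a) = 0"
        using combo_cong[of ?J "restrict (\<lambda>b. if b < ?n then x $ b else 0) ?J"] by simp
      thus "?f x \<in> PiE {..<j} (\<lambda>_. UNIV) \<times> ?L" by auto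
    qed
    show "finite (PiE {..<j} (\<lambda>_. UNIV :: 'a set) \<times> ?L)"
      by (intro finite_cartesian_product finite_PiE finite_subset[of ?L "PiE ?J (\<lambda>_. UNIV)"]) (auto intro: finite_PiE)
  qed
  also have "\<dots> \<le> ?q ^ j * ?q ^ (k - 1 - j)"
    using card_word_kernel_le[of j a j k, OF a0 jk aj] by (simp add: card_cartesian_product card_PiE_UNIV)
  also have "\<dots> = ?q ^ (k - 1)" using jk by (simp flip: power_add)
  finally show ?thesis .
qed

section \<open>Distance, dimension and support of the code\<close>

lemma rank_codeword_ge:
  assumes "a \<in> messages" "a \<noteq> (\<lambda>_. 0)"
  shows "s + r - k + 1 \<le> vec_space.rank m (codeword a)"
  by (rule rank_geI[OF codeword_carrier]) (use card_kernel_codeword_le[OF assms] k in auto)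

lemma codeword_ne_zero:
  assumes "a \<in> messages" "a \<noteq> (\<lambda>_. 0)" shows "codeword a \<noteq> 0\<^sub>m m (s + r)"
proof
  assume "codeword a = 0\<^sub>m m (s + r)"
  moreover have "vec_space.rank m (0\<^sub>m m (s + r) :: 'a mat) = 0" by (rule vec_space.rank_0I)
  ultimately show False using rank_codeword_ge[OF assms] by simp
qed

lemma inj_codeword: "inj_on codeword messages"
proof (rule inj_onI, rule ccontr)
  fix a c assume ac: "a \<in> messages" "c \<in> messages" "codeword a = codeword c" "a \<noteq> c"
  let ?d = "\<lambda>i. a i + to_ac (- 1) * c i"
  have "?d \<in> messages" by (intro messages_add messages_scale ac)
  moreover have "?d \<noteq> (\<lambda>_. 0)" using ac(4) by (auto simp: fun_eq_iff)
  ultimately have "codeword ?d \<noteq> 0\<^sub>m m (s + r)" by (rule codeword_ne_zero)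
  moreover have "codeword ?d = codeword a + (- 1) \<cdot>\<^sub>m codeword c"
    using codeword_add[OF ac(1) messages_scale[OF ac(2)]] codeword_scale[OF ac(2)] by metis
  ultimately show False using ac(3) codeword_carrier[of c] by (auto intro: eq_matI)
qed

text \<open>Interpolation makes the first \<open>k\<close> values independent parameters: they
  determine the coefficients and can be prescribed at will, each in a span of known size.\<close>

lemma card_messages: "card messages = CARD('a) ^ (\<Sum>b<k. \<gamma> ! b)"
proof -
  have "bij_betw (\<lambda>a. restrict (word k a) {..<k}) messages (PiE {..<k} (\<lambda>b. lspan {..<\<gamma> ! b} g))"
    unfolding bij_betw_def
  proof
    show "inj_on (\<lambda>a. restrict (word k a) {..<k}) messages"
    proof (intro inj_onI ext)
      fix a c i assume ac: "a \<in> messages" "c \<in> messages" "restrict (word k a) {..<k} = restrict (word k c) {..<k}"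
      have "word k (\<lambda>i. a i + (- 1) * c i) b = 0" if "b < k" for b
        unfolding word_add word_scale using fun_cong[OF ac(3), of b] that by simp
      hence "a i + (- 1) * c i = 0" if "i < k"
        using word_coefficients_eq_0[of k k "\<lambda>i. a i + (- 1) * c i" i] that by blast
      thus "a i = c i" using ac(1,2) by (cases "i < k") (auto simp: messages_def)
    qed
    show "(\<lambda>a. restrict (word k a) {..<k}) ` messages = PiE {..<k} (\<lambda>b. lspan {..<\<gamma> ! b} g)"
    proof
      show "(\<lambda>a. restrict (word k a) {..<k}) ` messages \<subseteq> PiE {..<k} (\<lambda>b. lspan {..<\<gamma> ! b} g)"
        by (intro image_subsetI PiE_I) (auto simp: messages_def)
      show "PiE {..<k} (\<lambda>b. lspan {..<\<gamma> ! b} g) \<subseteq> (\<lambda>a. restrict (word k a) {..<k}) ` messages"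
      proof
        fix u assume u: "u \<in> PiE {..<k} (\<lambda>b. lspan {..<\<gamma> ! b} g)"
        obtain a where a: "\<forall>i\<ge>k. a i = 0" "\<forall>b<k. word k a b = u b"
          using word_interpolate[of k k u] by blast
        have "u = restrict (word k a) {..<k}"
        proof
          fix b show "u b = restrict (word k a) {..<k} b"
            using u a(2) PiE_arb[OF u, of b] by (cases "b < k") auto
        qed
        moreover have "a \<in> messages" using a u by (auto simp: messages_def PiE_iff)
        ultimately show "u \<in> (\<lambda>a. restrict (word k a) {..<k}) ` messages" by blast
      qed
    qed
  qed
  hence "card messages = card (PiE {..<k} (\<lambda>b. lspan {..<\<gamma> ! b} g))" by (rule bij_betw_same_card)
  also have "\<dots> = (\<Prod>b<k. card (lspan {..<\<gamma> ! b} g))" by (simp add: card_PiE)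
  also have "\<dots> = (\<Prod>b<k. CARD('a) ^ (\<gamma> ! b))"
  proof (rule prod.cong)
    fix b assume "b \<in> {..<k}"
    hence "{..<\<gamma> ! b} \<subseteq> {..<T}" using first_columns[of b] by auto
    hence "indep {..<\<gamma> ! b} g" by (rule indep_subset[OF basis(1)]) simp
    thus "card (lspan {..<\<gamma> ! b} g) = CARD('a) ^ (\<gamma> ! b)" using card_lspan[of "{..<\<gamma> ! b}" g] by simp
  qed simp
  also have "\<dots> = CARD('a) ^ (\<Sum>b<k. \<gamma> ! b)" by (simp add: power_sum)
  finally show ?thesis .
qed

text \<open>This supplies a codeword that attains the distance. The value \<open>g 0\<close> is
  prescribed at position \<open>k - 1\<close> and 0 before it; \<open>g 0\<close> fits into any
  column, since each has at least one dot.\<close>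

lemma codeword_supported_last:
  "\<exists>A\<in>codeword ` messages. A \<noteq> 0\<^sub>m m (s + r) \<and> (\<forall>i<m. \<forall>b<k - 1. A $$ (i, b) = 0)"
proof -
  obtain a where a: "\<forall>i\<ge>k. a i = 0" "\<forall>b<k. word k a b = (if b = k - 1 then g 0 else 0)"
    using word_interpolate[of k k "\<lambda>b. if b = k - 1 then g 0 else 0"] by blast
  have "word k a b \<in> lspan {..<\<gamma> ! b} g" if "b < k" for b
  proof (cases "b = k - 1")
    case True
    have "g 0 \<in> lspan {..<\<gamma> ! b} g" by (rule lspan_base) (use \<gamma>_pos[of b] that k in auto)
    thus ?thesis using a(2) that True by simp
  next
    case False
    thus ?thesis using a(2) that lsubspace_zero[OF lsubspace_lspan] by simp
  qed
  hence am: "a \<in> messages" using a(1) by (simp add: messages_def)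
  have "pts 0 0 = g 0" using s by simp
  hence "g 0 \<noteq> 0" using pts_diag[of 0] by simp
  hence "a \<noteq> (\<lambda>_. 0)" using a(2)[rule_format, of "k - 1"] k by (auto simp: word_def)
  hence "codeword a \<noteq> 0\<^sub>m m (s + r)" by (rule codeword_ne_zero[OF am])
  moreover have "codeword a $$ (i, b) = 0" if "i < m" "b < k - 1" for i b
  proof -
    have "word k a b = 0" "b < s" using that a(2) k by auto
    moreover have "crd 0 i = 0" if "i < T"
      using coord_eq_0[OF basis(1) lsubspace_zero[OF lsubspace_lspan, of "{..<0}"] _ that] by simp
    ultimately show ?thesis using that by (simp add: codeword_def entry_def)
  qed
  ultimately show ?thesis using am by blast
qed

lemma codeword_support:
  assumes a: "a \<in> messages" and "i < m" "b < s + r" "(i, b) \<notin> dots \<gamma>"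
  shows "codeword a $$ (i, b) = 0"
proof -
  have i: "\<gamma> ! b \<le> i" using assms length_\<gamma> by (simp add: dots_def)
  have "lower a (b - s) (i - T) = 0" if "s \<le> b" "T \<le> i"
  proof (rule lower_eq_0[where j = 0])
    have "b - s < r" using that assms(3) by simp
    thus "height 0 (b - s) \<le> i - T"
      using last_columns[of "b - s"] that i by (simp add: height_def)
  qed simp
  thus ?thesis using assms crd_word_eq_0[OF a assms(3) i] by (simp add: codeword_def entry_def)
qed

theorem optimal_code:
  assumes "\<delta> = s + r - k + 1"
  shows "optimal_ferrers_code m (s + r) \<gamma> (\<Sum>b<k. \<gamma> ! b) \<delta> (codeword ` messages)"
proof (rule optimal_ferrers_codeI[OF subspace_code])
  show "card (codeword ` messages) = CARD('a) ^ (\<Sum>b<k. \<gamma> ! b)"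
    by (simp add: card_image[OF inj_codeword] card_messages)
  fix A assume A: "A \<in> codeword ` messages" "A \<noteq> 0\<^sub>m m (s + r)"
  then obtain a where "a \<in> messages" "A = codeword a" "a \<noteq> (\<lambda>_. 0)" using codeword_zero by blast
  thus "\<delta> \<le> vec_space.rank m A" using rank_codeword_ge assms by simp
qed (use assms k codeword_support codeword_supported_last length_\<gamma> in auto)

end

section \<open>The code for a chain of divisors\<close>

theorem theorem2p8:
  fixes l r \<delta> n k m w s2 q :: nat and t :: "nat \<Rightarrow> nat" and \<gamma> :: "nat list"
  assumes "1 \<le> l"
    and "t 0 = 1" and "\<forall>i<l. t i < t (i + 1)"
    and "\<forall>i. 1 \<le> i \<and> i < l \<longrightarrow> t i dvd t (i + 1)"
    and "1 < l \<longrightarrow> t 2 = s2 * t 1"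
    and "1 \<le> \<delta>" and "1 \<le> n" and "1 \<le> k"
    and "r + 1 \<le> \<delta>" and "\<delta> \<le> n - r"
    and "t (l - 1) < n - r" and "n - r \<le> t l"
    and "k = n - \<delta> + 1" and "k \<le> t 1"
    and "ferrers_diagram m n \<gamma>"
    and "if 1 < l then w \<in> {1..s2} else w = 1"
    and "\<gamma> ! (k - 1) \<le> w * t 1"
    and "k < t 1 \<and> 2 \<le> \<delta> \<longrightarrow> \<gamma> ! k \<ge> w * t 1"
    and "\<forall>\<theta>. 1 \<le> \<theta> \<and> \<theta> \<le> l - 1 \<longrightarrow> \<gamma> ! (t \<theta>) \<ge> t (\<theta> + 1)"
    and "\<forall>h<r. \<gamma> ! (n - r + h) \<ge> t l + (\<Sum>j=0..h. \<gamma> ! j)"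
    and "primepow q" and "CARD('a::{field,finite}) = q"
  shows "\<exists>C :: 'a mat set. optimal_ferrers_code m n \<gamma> (\<Sum>i=0..k-1. \<gamma> ! i) \<delta> C"
proof -
  define s where "s = n - r"
  define T where "T = t l"
  \<comment> \<open>\<open>c * t 1\<close> is the degree of the field that is to contain the
    intermediate space: \<open>t 2\<close>, or \<open>t 1\<close> itself if
    \<open>l = 1\<close>.\<close>
  define c where "c = (if 1 < l then s2 else 1)"
  have pp: "primepow CARD('a)" using assms(21,22) by simp
  have s: "1 \<le> s" "s \<le> T" and n: "n = s + r" and k: "k \<le> s"
    using assms(7,9-13) by (auto simp: s_def T_def)
  have \<gamma>_mono: "\<gamma> ! i \<le> \<gamma> ! j" if "i \<le> j" "j < n" for i j
    using assms(15) that unfolding ferrers_diagram_def by (simp add: sorted_iff_nth_mono)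
  have t_mono: "t i \<le> t j" if "i \<le> j" "j \<le> l" for i j
    using that
  proof (induction rule: dec_induct)
    case (step j)
    thus ?case using assms(3)[rule_format, of j] by simp
  qed simp
  have t_dvd: "t i dvd t j" if "i \<le> j" "1 \<le> i" "j \<le> l" for i j
    using that by (induction rule: dec_induct) (use assms(4) in \<open>auto intro: dvd_trans\<close>)
  have t1: "1 \<le> t 1" using t_mono[of 0 1] assms(1,2) by simp
  have w: "1 \<le> w" "w \<le> c" using assms(1,16) by (auto simp: c_def split: if_splits)
  have ct: "c * t 1 = t (if 1 < l then 2 else 1)" using assms(5) by (simp add: c_def)
  from intermediate_subspace[OF pp t1 w] obtain V :: "'a alg_closure set" where
    V: "lsubspace V" "card V = CARD('a) ^ (w * t 1)" "fixed_field (t 1) \<subseteq> V" "V \<subseteq> fixed_field (c * t 1)"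
      "\<And>x v. x \<in> fixed_field (t 1) \<Longrightarrow> v \<in> V \<Longrightarrow> x * v \<in> V"
    by blast

  \<comment> \<open>The intermediate space \<open>V\<close> takes slot 1 of the flag, and the field
    of degree \<open>t 1\<close> moves to slot 0, where \<open>t 0 = 1\<close> would give only the
    base field.\<close>
  define W where "W = (\<lambda>i. if i = 0 then fixed_field (t 1) else if i = 1 then V else fixed_field (t i))"
  define d where "d = (\<lambda>i. if i = 0 then t 1 else if i = 1 then w * t 1 else t i)"
  have "\<exists>g. \<forall>i\<le>l. indep {..<d i} g \<and> lspan {..<d i} g = W i"
  proof (rule flag_basis)
    fix i
    show "lsubspace (W i)" using lsubspace_fixed_field[OF pp] V(1) by (simp add: W_def)
    assume i: "i \<le> l"
    show "card (W i) = CARD('a) ^ d i"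
      using card_fixed_field[OF pp t1] card_fixed_field[OF pp, of "t i"] V(2) t_mono[OF _ i, of 0] assms(2)
      by (auto simp: W_def d_def)
  next
    fix i assume i: "i < l"
    consider "i = 0" | "i = 1" | "2 \<le> i" by linarith
    thus "W i \<subseteq> W (Suc i)"
    proof cases
      case 2
      thus ?thesis using V(4) ct i by (simp add: W_def numeral_2_eq_2)
    next
      case 3
      thus ?thesis using fixed_field_subset[OF t_dvd[of i "Suc i"]] i by (simp add: W_def)
    qed (use V(3) in \<open>simp add: W_def\<close>)
  qed
  then obtain g where g: "\<And>i. i \<le> l \<Longrightarrow> indep {..<d i} g \<and> lspan {..<d i} g = W i" by blast
  have gV: "lspan {..<w * t 1} g = V" using g[of 1] assms(1) by (simp add: d_def W_def)
  have gt: "lspan {..<t i} g = fixed_field (t i)" if "1 \<le> i" "i \<le> l" for i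
    using g[of i] g[of 0] that by (cases "i = 1") (auto simp: d_def W_def)
  have g_flag: "g b \<in> fixed_field (t i)" if "b < t i" "1 \<le> i" "i \<le> l" for b i
    using lspan_base[of "{..<t i}" b g] gt[of i] that by simp
  have gT: "lspan {..<T} g = fixed_field T" using gt[of l] assms(1) by (simp add: T_def)
  \<comment> \<open>For \<open>l = 1\<close> the last slot is \<open>V\<close>, of dimension
    \<open>t 1 = T\<close> because then \<open>w = 1\<close>.\<close>
  have "d l = T" using assms(1,16) by (auto simp: d_def T_def)
  hence g_basis: "indep {..<T} g" using g[of l] by simp
  have wT: "w * t 1 \<le> T"
  proof -
    have "w * t 1 \<le> c * t 1" using w(2) by simp
    also have "\<dots> \<le> T" unfolding ct T_def by (rule t_mono) (use assms(1) in auto)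
    finally show ?thesis .
  qed

  interpret newton_points g s T
  proof
    show "indep {..<s} g" by (rule indep_subset[OF g_basis]) (use s in auto)
    show "g b \<in> fixed_field T" if "b < s" for b
      using g_flag[of b l] that s(2) assms(1) by (simp add: T_def)
  qed (use pp s in auto)

  have first: "\<gamma> ! b \<le> w * t 1" if "b < k" for b
  proof -
    have "b \<le> k - 1" "k - 1 < n" using that k n by auto
    thus ?thesis using \<gamma>_mono assms(17) by (meson order.trans)
  qed
  have middle: "word k a b \<in> lspan {..<\<gamma> ! b} g"
    if b: "k \<le> b" "b < s" and a: "\<And>i. i < k \<Longrightarrow> word k a i \<in> lspan {..<\<gamma> ! i} g" for a b
  proof -
    \<comment> \<open>Since \<open>k \<le> t 1\<close>, the points with index below \<open>k\<close>
      lie in the field of degree \<open>t 1\<close>, by which \<open>V\<close> may be multiplied.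
      Values in \<open>V\<close> thus force coefficients in \<open>V\<close>.\<close>
    have aV: "a i \<in> V" if "i < k" for i
    proof (rule word_coefficients_in[where t = "t 1" and j = k and k = k])
      fix b assume "b < k"
      thus "word k a b \<in> V"
        using lspan_mono[of "{..<w * t 1}" "{..<\<gamma> ! b}" g] a[of b] first[of b] gV by auto
    next
      fix i b assume "b < k"
      hence "b < s" "b < t 1" using k assms(14) by auto
      thus "pts i b \<in> fixed_field (t 1)"
        using assms(1) by (intro pts_subfield g_flag) auto
    qed (use V that in auto)
    show ?thesis
    proof (cases "b < t 1")
      case True
      have "pts i b \<in> fixed_field (t 1)" for i
        using True b assms(1) by (intro pts_subfield g_flag) auto
      hence "word k a b \<in> V"
        unfolding word_def using V(1,5) aV by (auto intro!: lsubspace_sum simp: mult.commute[of "a _"])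
      moreover have "w * t 1 \<le> \<gamma> ! b"
      proof -
        \<comment> \<open>A middle column with index below \<open>t 1\<close> occurs only when the
          second condition on the diagram is in force; monotonicity carries the height from column
          \<open>k\<close> to column \<open>b\<close>.\<close>
        have "k < t 1" "2 \<le> \<delta>" using True b n assms(6,13) by auto
        hence "w * t 1 \<le> \<gamma> ! k" using assms(18) by simp
        thus ?thesis using \<gamma>_mono[of k b] b n by simp
      qed
      ultimately show ?thesis using lspan_mono[of "{..<\<gamma> ! b}" "{..<w * t 1}" g] gV by auto
    next
      case False
      \<comment> \<open>The field of degree \<open>t \<mu>\<close> contains the points up to
        \<open>g b\<close>. By minimality \<open>t (\<mu> - 1) \<le> b\<close>, so the third
        condition at \<open>\<mu> - 1\<close> gives column \<open>b\<close> at least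
        \<open>t \<mu>\<close> dots.\<close>
      define \<mu> where "\<mu> = (LEAST i. b < t i)"
      have bT: "b < t l" using b s(2) by (simp add: T_def)
      have b\<mu>: "b < t \<mu>" unfolding \<mu>_def by (rule LeastI) (rule bT)
      have \<mu>l: "\<mu> \<le> l" unfolding \<mu>_def by (rule Least_le) (rule bT)
      have "\<mu> \<noteq> 0" "\<mu> \<noteq> 1" using b\<mu> False t1 assms(2) by (auto intro: Nat.gr0I)
      then obtain \<theta> where \<theta>: "\<mu> = \<theta> + 1" "1 \<le> \<theta>" by (cases \<mu>) auto
      hence "t \<theta> \<le> b" using not_less_Least[of \<theta> "\<lambda>i. b < t i"] by (simp add: \<mu>_def)
      have l: "1 < l" using \<theta> \<mu>l by simp
      \<comment> \<open>\<open>V\<close> lies in the field of degree \<open>t 2\<close> and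
        \<open>\<mu> \<ge> 2\<close>, so coefficients and points come together in the field of
        degree \<open>t \<mu>\<close>.\<close>
      have "V \<subseteq> fixed_field (t \<mu>)"
        using V(4) ct l fixed_field_subset[OF t_dvd[of 2 \<mu>]] \<theta> \<mu>l by auto
      moreover have "pts i b \<in> fixed_field (t \<mu>)" for i
        using b\<mu> b \<theta> \<mu>l by (intro pts_subfield g_flag) auto
      ultimately have "word k a b \<in> fixed_field (t \<mu>)"
        unfolding word_def using aV by (auto intro!: lsubspace_sum lsubspace_fixed_field[OF pp] fixed_field_mult)
      hence "word k a b \<in> lspan {..<t \<mu>} g" using gt[of \<mu>] \<theta> \<mu>l by simp
      moreover have "t \<mu> \<le> \<gamma> ! b"
      proof -
        have "\<theta> \<le> l - 1" using \<theta> \<mu>l by simp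
        hence "t \<mu> \<le> \<gamma> ! t \<theta>" using assms(19) \<theta> by blast
        thus ?thesis using \<gamma>_mono[OF \<open>t \<theta> \<le> b\<close>] b n by simp
      qed
      ultimately show ?thesis using lspan_mono[of "{..<\<gamma> ! b}" "{..<t \<mu>}" g] by auto
    qed
  qed

  interpret staircase_code g s T \<gamma> m r k
  proof
    show "\<gamma> ! b \<le> T" if "b < k" for b
      using first[OF that] wT by simp
    show "T + (\<Sum>j=0..h. \<gamma> ! j) \<le> \<gamma> ! (s + h)" if "h < r" for h
      using assms(20) that by (simp add: s_def T_def)
  qed (use g_basis gT assms(8,15) n k middle in auto)
  have "(\<Sum>b<k. \<gamma> ! b) = (\<Sum>i=0..k-1. \<gamma> ! i)"
    by (rule sum.cong) (use assms(8) in auto)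
  moreover have "\<delta> = s + r - k + 1" using assms(6,10,13) n by simp
  ultimately show ?thesis using optimal_code[of \<delta>] n by auto
qed

end
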